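(* Let $X_1,X_2,\dots$ be i.i.d. with ${\sf E}X_1=0$ and $0<\sigma^2={\sf E}X_1^2<\infty$. Let $\Lambda_n$ be a positive random variable with ${\sf E}\Lambda_n<\infty$ and let $N_n^\star$ be a nonnegative integer-valued random variable, independent of $X_1,X_2,\dots$, with the mixed Poisson distribution $${\sf P}(N_n^\star=k)=\int_0^\infty e^{-\lambda}\frac{\lambda^k}{k!}\,d{\sf P}(\Lambda_n<\lambda),\quad k=0,1,2,\dots$$ Then $$\Delta_n^\star\equiv\sup_x\Big|{\sf P}\big(S_{N_n^\star}<x\sigma\sqrt{{\sf E}\Lambda_n}\big)-\int_0^\infty\Phi\Big(\frac{x}{\sqrt\lambda}\Big)d{\sf P}(\Lambda_n<\lambda{\sf E}\Lambda_n)\Big|\le\frac{1.8546}{\sigma^2}{\sf E}X_1^2\min\Big\{1,\frac{|X_1|}{\sigma\sqrt{\Lambda_n}}\Big\}$$ $$=\frac{1.8546}{\sigma^2}\Big[{\sf E}X_1^2\mathbb I\big(|X_1|\ge\sigma\sqrt{\Lambda_n}\big)+{\sf E}\frac{|X_1|^3}{\sigma\sqrt{\Lambda_n}}\mathbb I\big(|X_1|<\sigma\sqrt{\Lambda_n}\big)\Big],$$ where in the expectations on the right-hand side $X_1$ and $\Lambda_n$ are taken independent.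
   Context: $S_N=X_1+\dots+X_N$, $S_N=0$ if $N=0$. $\Phi$ is the standard normal distribution function; $\mathbb I(A)$ is the indicator of $A$. *)

theory Defs
  imports "HOL-Probability.Probability"
begin

definition Phi :: "real \<Rightarrow> real" where
  "Phi x = measure (density lborel std_normal_density) {..x}"

end

(* Stein's method. For l > 0 let S be a Poisson(l) sum of independent copies of Y = X_1 / (sigma sqrt l).
   The identity E S f(S) = l E Y f(S + Y), with Y independent of S, turns into
   E S f(S) = E f'(S + U), where U is independent of S and has the zero-bias law of Y. For the solution f of
   the Stein equation of the half-line below y, the discrepancy P(S < y) - Phi(y) is therefore the sum of
   E[S f(S) - (S + U) f(S + U)] and P(S < y) - P(S + U < y). Since w f(w) is monotone with total variation 1,
   for a given value u of U the two terms have opposite signs, so only the larger one counts; each is at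
   most min(1, c |u|), the second one after averaging y over an interval of length d, with a constant c that involves
   the supremum D of the discrepancy. With eps = l E Y^2 min(1, |Y|) and d = 2 eps this gives
   D <= 1.708 eps. Integrating over the law of l yields the theorem. *)
theory Submission imports Defs "HOL-Real_Asymp.Real_Asymp" begin

subsection \<open>The standard normal distribution function and its Mills ratio\<close>

text \<open>The law of S has atoms (0 has mass at least exp(-l)), so at a fixed y no bound linear in
  |u| holds for P(S < y) - P(S + u < y). Its average over a window of length d is controlled by the
  increment of the distribution function over distance d, at most d / sqrt(2 pi) + 2 D, so D returns
  on the right. It can be absorbed because U is the product of a square-biased copy of Y and an
  independent uniform variable, whose mean 1/2 turns c into c / 2. With d = 2 eps the part 2 D / d
  of c contributes only D / 2, and the passage from averages back to points costs d / (2 sqrt(2 pi))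
  <= eps / 2. Truncating at 1 is what lets a second moment suffice. The Poisson number of summands
  is what makes the shift independent of the whole sum; for a fixed number one summand would have to
  be left out. The laws compared in the claim and the bound are all mixtures over \<Lambda>, so a
  constant that is uniform in l survives integration.\<close>

abbreviation nd :: "real \<Rightarrow> real" where "nd \<equiv> std_normal_density"

lemma nd_eq: "nd x = exp (- x\<^sup>2 / 2) / sqrt (2 * pi)"
  by (simp add: std_normal_density_def)

lemma nd_pos: "nd x > 0"
  by (simp add: normal_density_pos)

lemma nd_minus: "nd (- x) = nd x"
  by (simp add: nd_eq)

lemma nd_le: "nd x \<le> 1 / sqrt (2 * pi)"
  by (simp add: nd_eq divide_right_mono)

lemma nd_deriv: "(nd has_real_derivative (- x * nd x)) (at x)"
proof -
  have "((\<lambda>x. c * exp (- x\<^sup>2 / 2)) has_real_derivative - x * (c * exp (- x\<^sup>2 / 2))) (at x)" for c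
    by (auto intro!: derivative_eq_intros)
  from this[of "1 / sqrt (2 * pi)"] show ?thesis by (simp add: std_normal_density_def[abs_def])
qed

lemma nd_isCont: "isCont nd x"
  using nd_deriv DERIV_isCont by blast

interpretation std_normal: real_distribution "density lborel nd"
  by (simp add: real_distribution_def real_distribution_axioms_def prob_space_normal_density)

lemma Phi_cdf: "Phi = cdf (density lborel nd)"
  by (simp add: fun_eq_iff Phi_def cdf_def)

lemma Phi_bot: "(Phi \<longlongrightarrow> 0) at_bot"
  unfolding Phi_cdf by (rule std_normal.cdf_lim_at_bot)

lemma Phi_top: "(Phi \<longlongrightarrow> 1) at_top"
  unfolding Phi_cdf by (rule std_normal.cdf_lim_at_top_prob)

lemma Phi_nonneg: "Phi x \<ge> 0" and Phi_le_1: "Phi x \<le> 1"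
  unfolding Phi_cdf by (auto simp: std_normal.cdf_nonneg std_normal.cdf_bounded_prob)

lemma Phi_mono: "x \<le> y \<Longrightarrow> Phi x \<le> Phi y"
  unfolding Phi_cdf by (rule std_normal.cdf_nondecreasing)

lemma Phi_diff:
  assumes "a \<le> b" shows "Phi b = Phi a + integral {a..b} nd"
proof -
  have c: "continuous_on {a..b} nd" by (simp add: continuous_at_imp_continuous_on nd_isCont)
  have i: "set_integrable lborel {a..b} nd"
    using c by (rule borel_integrable_atLeastAtMost')
  have ii: "set_integrable lborel {a<..b} nd"
    by (rule set_integrable_subset[OF i]) auto
  have "Phi b - Phi a = measure (density lborel nd) {a<..b}"
    unfolding Phi_cdf using std_normal.cdf_diff_eq[of a b] assms by (cases "a = b") auto
  also have "\<dots> = (\<integral>x. indicator {a<..b} x \<partial>density lborel nd)"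
    by simp
  also have "\<dots> = (LBINT x:{a<..b}. nd x)"
    by (subst integral_density) (auto simp: set_lebesgue_integral_def mult.commute)
  also have "\<dots> = (LBINT x:{a..b}. nd x)"
    by (rule set_integral_cong_set) (auto simp: set_borel_measurable_def intro!: AE_I[where N="{a}"])
  also have "\<dots> = integral {a..b} nd"
    using i by (rule set_borel_integral_eq_integral)
  finally show ?thesis by simp
qed

lemma Phi_deriv: "(Phi has_real_derivative nd x) (at x)"
proof -
  have c: "continuous_on {x-1..x+1} nd" by (simp add: continuous_at_imp_continuous_on nd_isCont)
  have "((\<lambda>u. integral {x-1..u} nd) has_real_derivative nd x) (at x within {x-1..x+1})"
    using integral_has_real_derivative[OF c, of x] by simp
  then have "((\<lambda>u. Phi (x-1) + integral {x-1..u} nd) has_real_derivative nd x) (at x within {x-1..x+1})"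
    by (auto intro!: derivative_eq_intros)
  then have "(Phi has_real_derivative nd x) (at x within {x-1..x+1})"
    by (rule has_field_derivative_transform_within[where d=1]) (auto simp: Phi_diff)
  moreover have "at x within {x-1..x+1} = at x"
    by (rule at_within_interior) auto
  ultimately show ?thesis by simp
qed

text \<open>Since \<open>nd\<close> is even, \<open>Phi x + Phi (- x)\<close> has derivative 0; its
  limit at infinity identifies the constant as 1.\<close>

lemma Phi_minus: "Phi (- x) = 1 - Phi x"
proof -
  have d: "((\<lambda>x. Phi x + Phi (- x)) has_real_derivative 0) (at x)" for x
    by (auto intro!: derivative_eq_intros Phi_deriv[THEN DERIV_chain2] simp: nd_minus)
  have const: "Phi z + Phi (- z) = Phi 0 + Phi (- 0)" for z
    using DERIV_const_ratio_const2[of z 0 "\<lambda>x. Phi x + Phi (- x)" 0] d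
    by (cases "z = 0") auto
  have "((\<lambda>z. Phi z + Phi (- z)) \<longlongrightarrow> 1 + 0) at_top"
    by (intro tendsto_add Phi_top filterlim_compose[OF Phi_bot] filterlim_uminus_at_bot_at_top)
  then have "((\<lambda>z::real. Phi 0 + Phi (- 0)) \<longlongrightarrow> 1) at_top"
    using const by simp
  then have "Phi 0 + Phi (- 0) = 1"
    by (simp add: tendsto_const_iff)
  with const[of x] show ?thesis by simp
qed

lemma Phi_lipschitz:
  assumes "x \<le> y" shows "Phi y - Phi x \<le> (y - x) / sqrt (2 * pi)"
proof (cases "x = y")
  case False
  then obtain z where "Phi y - Phi x = (y - x) * nd z"
    using MVT2[of x y Phi nd] assms Phi_deriv by (meson order_le_less)
  then show ?thesis using mult_left_mono[OF nd_le[of z], of "y - x"] assms by simp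
qed simp

text \<open>A nondecreasing function that starts from the limit 0 cannot be negative. Each Gaussian
  tail inequality below is reduced by this to the sign of a derivative, without improper
  integrals.\<close>

lemma DERIV_nonneg_at_bot_imp_nonneg:
  fixes h :: "real \<Rightarrow> real"
  assumes d: "\<And>x. (h has_real_derivative h' x) (at x)" and n: "\<And>x. h' x \<ge> 0"
    and l: "(h \<longlongrightarrow> 0) at_bot"
  shows "h x \<ge> 0"
proof (rule tendsto_upperbound[OF l])
  show "\<forall>\<^sub>F y in at_bot. h y \<le> h x"
    using eventually_le_at_bot[of x] 
    proof eventually_elim
      case (elim y)
      show ?case by (rule DERIV_nonneg_imp_nondecreasing[OF elim]) (use d n in blast)
    qed
qed simp

text \<open>The exponents compare because (t + 1)^2 is nonnegative. The bound is crude, but it makes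
  \<open>Phi\<close> beat every power at minus infinity, which supplies the limits 0 in the two
  Mills inequalities.\<close>

lemma Phi_le_exp: "Phi x \<le> exp (x + 1/2)"
proof -
  have "nd t \<le> exp (t + 1/2)" for t
  proof -
    have "- t\<^sup>2 / 2 \<le> t + 1/2" using zero_le_power2[of "t + 1"] by (simp add: power2_eq_square algebra_simps)
    moreover have "sqrt (2 * pi) \<ge> 1" using pi_ge_two by (simp add: real_le_rsqrt)
    then have "nd t \<le> exp (- t\<^sup>2 / 2) / 1"
      unfolding nd_eq by (intro divide_left_mono) auto
    ultimately show ?thesis
      by (simp add: order_trans)
  qed
  then have "\<And>t. exp (t + 1/2) - nd t \<ge> 0" by simp
  moreover have "((\<lambda>t. exp (t + 1/2) - Phi t) has_real_derivative exp (t + 1/2) - nd t) (at t)" for t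
    by (auto intro!: derivative_eq_intros Phi_deriv)
  moreover have "((\<lambda>t::real. exp (t + 1/2)) \<longlongrightarrow> 0) at_bot" by real_asymp
  then have "((\<lambda>t. exp (t + 1/2) - Phi t) \<longlongrightarrow> 0) at_bot"
    using tendsto_diff[OF _ Phi_bot] by force
  ultimately have "exp (x + 1/2) - Phi x \<ge> 0"
    by (intro DERIV_nonneg_at_bot_imp_nonneg[where h = "\<lambda>t. exp (t + 1/2) - Phi t"
          and h' = "\<lambda>t. exp (t + 1/2) - nd t"])
  then show ?thesis by simp
qed

lemma power_Phi_bot: "((\<lambda>x. x ^ k * Phi x) \<longlongrightarrow> 0) at_bot"
proof (rule tendsto_rabs_zero_cancel, rule tendsto_sandwich[of "\<lambda>_. 0"])
  show "\<forall>\<^sub>F x in at_bot. \<bar>x ^ k * Phi x\<bar> \<le> \<bar>x\<bar> ^ k * exp (x + 1/2)"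
    by (auto simp: abs_mult power_abs Phi_nonneg intro!: always_eventually mult_left_mono Phi_le_exp)
  have "((\<lambda>x::real. exp (1/2) * (x ^ k / exp x)) \<longlongrightarrow> 0) at_top"
    using tendsto_mult_left[OF tendsto_power_div_exp_0] by force
  moreover have "exp (1/2) * (x ^ k / exp x) = \<bar>- x\<bar> ^ k * exp (- x + 1/2)" if "x \<ge> 0" for x :: real
  proof -
    have "exp (- x + 1/2) = exp (1/2) / exp x"
      by (metis exp_diff uminus_add_conv_diff)
    moreover have "\<bar>- x\<bar> = x" using that by simp
    ultimately show ?thesis by (simp only: times_divide_eq_right times_divide_eq_left mult.commute)
  qed
  then have "\<forall>\<^sub>F x::real in at_top. exp (1/2) * (x ^ k / exp x) = \<bar>- x\<bar> ^ k * exp (- x + 1/2)"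
    unfolding eventually_at_top_linorder by (intro exI[of _ 0] allI impI)
  ultimately have "((\<lambda>x::real. \<bar>- x\<bar> ^ k * exp (- x + 1/2)) \<longlongrightarrow> 0) at_top"
    by (rule Lim_transform_eventually)
  then show "((\<lambda>x::real. \<bar>x\<bar> ^ k * exp (x + 1/2)) \<longlongrightarrow> 0) at_bot"
    unfolding filterlim_at_bot_mirror .
qed auto

lemma nd_bot: "(nd \<longlongrightarrow> 0) at_bot" "((\<lambda>x. x * nd x) \<longlongrightarrow> 0) at_bot"
  unfolding nd_eq by real_asymp+

lemma mills_upper: "nd w + w * Phi w \<ge> 0"
proof (rule DERIV_nonneg_at_bot_imp_nonneg[where h = "\<lambda>w. nd w + w * Phi w" and h' = Phi])
  show "((\<lambda>w. nd w + w * Phi w) \<longlongrightarrow> 0) at_bot"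
    using tendsto_add[OF nd_bot(1) power_Phi_bot[of 1]] by simp
qed (auto intro!: derivative_eq_intros nd_deriv Phi_deriv Phi_nonneg)

text \<open>The derivative of the left side is twice the expression of \<open>mills_upper\<close>,
  whose own derivative is \<open>Phi\<close>. Divided by \<open>nd\<close>, this is the sign of the
  derivative of \<open>w * mills w\<close>.\<close>

lemma mills_lower: "(1 + w\<^sup>2) * Phi w + w * nd w \<ge> 0"
proof (rule DERIV_nonneg_at_bot_imp_nonneg[where h = "\<lambda>w. (1 + w\<^sup>2) * Phi w + w * nd w"
      and h' = "\<lambda>w. 2 * (nd w + w * Phi w)"])
  show "((\<lambda>w. (1 + w\<^sup>2) * Phi w + w * nd w) \<longlongrightarrow> 0) at_bot"
    using tendsto_add[OF tendsto_add[OF Phi_bot power_Phi_bot[of 2]] nd_bot(2)] by (simp add: algebra_simps)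
  show "0 \<le> 2 * (nd x + x * Phi x)" for x
    using mills_upper[of x] by simp
qed (auto intro!: derivative_eq_intros nd_deriv Phi_deriv simp: algebra_simps power2_eq_square)

text \<open>The Mills ratio of the lower tail; \<open>mills (- w)\<close> is the classical one of
  the upper tail. It solves m' = 1 + w m, so multiples of \<open>mills w\<close> and
  \<open>mills (- w)\<close> solve the Stein equation on the two sides of its jump.\<close>

definition mills :: "real \<Rightarrow> real" where "mills w = Phi w / nd w"

lemma mills_nonneg: "mills w \<ge> 0"
  by (simp add: mills_def Phi_nonneg nd_pos[THEN less_imp_le])

lemma mills_deriv: "(mills has_real_derivative (1 + w * mills w)) (at w)"
  unfolding mills_def[abs_def]
  by (rule derivative_eq_intros Phi_deriv nd_deriv refl | use nd_pos[of w] in \<open>simp add: field_simps\<close>)+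

lemma mills_ge: "1 + w * mills w \<ge> 0"
  using mills_upper[of w] nd_pos[of w] by (simp add: mills_def field_simps)

lemma mills_mono: "v \<le> w \<Longrightarrow> mills v \<le> mills w"
  by (rule DERIV_nonneg_imp_nondecreasing) (use mills_deriv mills_ge in blast)+

lemma mills_le: assumes "w \<le> 0" shows "mills w \<le> sqrt (2 * pi) / 2"
proof -
  have "mills 0 = sqrt (2 * pi) / 2"
    using Phi_minus[of 0] by (simp add: mills_def nd_eq)
  with mills_mono[OF assms] show ?thesis by simp
qed

lemma times_mills_mono: assumes "v \<le> w" shows "v * mills v \<le> w * mills w"
proof (rule DERIV_nonneg_imp_nondecreasing[OF assms])
  fix x
  have "((\<lambda>w. w * mills w) has_real_derivative ((1 + x\<^sup>2) * mills x + x)) (at x)"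
    by (auto intro!: derivative_eq_intros mills_deriv simp: algebra_simps power2_eq_square)
  moreover have "(1 + x\<^sup>2) * mills x + x \<ge> 0"
    using mills_lower[of x] nd_pos[of x] by (simp add: mills_def field_simps)
  ultimately show "\<exists>y. ((\<lambda>w. w * mills w) has_real_derivative y) (at x) \<and> 0 \<le> y" by blast
qed

subsection \<open>The Stein equation of a half-line\<close>

lemma mills_isCont [simp]: "isCont mills w"
  using mills_deriv DERIV_isCont by blast

lemma mills_measurable [measurable]: "mills \<in> borel_measurable borel"
  by (intro borel_measurable_continuous_onI continuous_at_imp_continuous_on) auto

lemma Phi_measurable [measurable]: "Phi \<in> borel_measurable borel"
  by (intro borel_measurable_continuous_onI continuous_at_imp_continuous_on)
    (auto intro: DERIV_isCont[OF Phi_deriv])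

text \<open>The bounded solution of f'(w) - w f(w) = 1(w < y) - \<open>Phi y\<close>. Each branch
  uses the Mills ratio that stays bounded on its own side of y.\<close>

definition stein_sol :: "real \<Rightarrow> real \<Rightarrow> real" where
  "stein_sol y w = (if w \<le> y then mills w * (1 - Phi y) else Phi y * mills (- w))"

text \<open>Read off from the equation, so it is defined also at the kink \<open>w = y\<close>,
  where it is the right-hand derivative. The half-line is open because the theorem compares
  probabilities of strict inequalities.\<close>

definition stein_der :: "real \<Rightarrow> real \<Rightarrow> real" where
  "stein_der y w = w * stein_sol y w + indicator {..<y} w - Phi y"

lemma stein_sol_glue: "mills y * (1 - Phi y) = Phi y * mills (- y)"
  by (simp add: mills_def Phi_minus nd_minus)

lemma stein_sol_alt: "stein_sol y w = (if w < y then mills w * (1 - Phi y) else Phi y * mills (- w))"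
  using stein_sol_glue[of y] by (auto simp: stein_sol_def)

lemma stein_sol_measurable [measurable]:
  "(\<lambda>(y, w). stein_sol y w) \<in> borel_measurable (borel \<Otimes>\<^sub>M borel)"
  unfolding stein_sol_def[abs_def] by measurable

lemma stein_sol_measurable1 [measurable]: "stein_sol y \<in> borel_measurable borel"
  unfolding stein_sol_def[abs_def] by measurable

lemma stein_der_measurable1 [measurable]: "stein_der y \<in> borel_measurable borel"
  unfolding stein_der_def[abs_def] by measurable

lemma stein_sol_nonneg: "stein_sol y w \<ge> 0"
  by (simp add: stein_sol_def mills_nonneg Phi_nonneg Phi_le_1)

text \<open>On both branches the solution is at most \<open>mills (- \<bar>w\<bar>)\<close>, hence
  at most \<open>mills 0\<close>. If w lies between 0 and y, monotonicity of \<open>Phi\<close>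
  first moves the kink to w, where the gluing identity allows a change of branch.\<close>

lemma stein_sol_le: "stein_sol y w \<le> sqrt (2 * pi) / 2"
proof (cases "w \<le> y")
  case True
  have "stein_sol y w \<le> mills (- \<bar>w\<bar>)"
  proof (cases "w \<le> 0")
    case True
    then show ?thesis using \<open>w \<le> y\<close> Phi_nonneg[of y] Phi_le_1[of y]
      by (simp add: stein_sol_def mult_right_le_one_le mills_nonneg)
  next
    case False
    have "mills w * (1 - Phi y) \<le> mills w * (1 - Phi w)"
      using \<open>w \<le> y\<close> by (intro mult_left_mono) (auto simp: Phi_mono mills_nonneg)
    also have "\<dots> = Phi w * mills (- w)" by (rule stein_sol_glue)
    also have "\<dots> \<le> mills (- w)"
      by (simp add: mult_left_le_one_le Phi_nonneg Phi_le_1 mills_nonneg)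
    finally show ?thesis using False \<open>w \<le> y\<close> by (simp add: stein_sol_def)
  qed
  also have "\<dots> \<le> sqrt (2 * pi) / 2" by (rule mills_le) simp
  finally show ?thesis .
next
  case False
  have "stein_sol y w \<le> mills (- \<bar>w\<bar>)"
  proof (cases "w \<ge> 0")
    case True
    then show ?thesis using \<open>\<not> w \<le> y\<close> Phi_nonneg[of y] Phi_le_1[of y]
      by (simp add: stein_sol_def mult_left_le_one_le mills_nonneg)
  next
    case neg: False
    have "Phi y * mills (- w) \<le> Phi w * mills (- w)"
      using False by (intro mult_right_mono) (auto simp: Phi_mono mills_nonneg)
    also have "\<dots> = mills w * (1 - Phi w)" by (rule stein_sol_glue[symmetric])
    also have "\<dots> \<le> mills w"
      by (simp add: mult_right_le_one_le Phi_nonneg Phi_le_1 mills_nonneg)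
    finally show ?thesis using neg False by (simp add: stein_sol_def)
  qed
  also have "\<dots> \<le> sqrt (2 * pi) / 2" by (rule mills_le) simp
  finally show ?thesis .
qed

text \<open>Each branch is a nonnegative multiple of \<open>w * mills w\<close> or of its
  reflection, and the branches agree at y. Values on opposite sides are compared through y.\<close>

lemma times_stein_sol_mono:
  assumes "v \<le> w" shows "v * stein_sol y v \<le> w * stein_sol y w"
proof -
  have left: "v * stein_sol y v \<le> w * stein_sol y w" if "v \<le> w" "w \<le> y" for v w
    using mult_right_mono[OF times_mills_mono[OF that(1)], of "1 - Phi y"] that Phi_le_1[of y]
    by (simp add: stein_sol_def mult.assoc)
  have right: "v * stein_sol y v \<le> w * stein_sol y w" if "v \<le> w" "y \<le> v" for v w
  proof -
    have "Phi y * (- w * mills (- w)) \<le> Phi y * (- v * mills (- v))"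
      by (rule mult_left_mono[OF times_mills_mono]) (use that in \<open>auto simp: Phi_nonneg\<close>)
    then show ?thesis using that by (simp add: stein_sol_alt algebra_simps)
  qed
  show ?thesis
    using left[of v w] right[of v w] left[of v y] right[of y w] assms by linarith
qed

text \<open>Left of y this is \<open>mills_ge\<close> multiplied by \<open>1 - Phi y\<close>; right
  of y monotonicity carries it over. Together with the upper bound \<open>Phi y\<close> it confines
  \<open>w * stein_sol y w\<close> to an interval of length 1.\<close>

lemma times_stein_sol_ge: "w * stein_sol y w \<ge> Phi y - 1"
proof -
  have *: "w * stein_sol y w \<ge> Phi y - 1" if "w \<le> y" for w
    using mult_right_mono[OF mills_ge[of w], of "1 - Phi y"] that Phi_le_1[of y]
    by (simp add: stein_sol_def algebra_simps)
  show ?thesis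
    using *[of w] *[of y] times_stein_sol_mono[of y w y] by linarith
qed

lemma times_stein_sol_le: "w * stein_sol y w \<le> Phi y"
proof -
  have *: "w * stein_sol y w \<le> Phi y" if "y \<le> w" for w
    using mult_left_mono[OF mills_ge[of "- w"], of "Phi y"] that Phi_nonneg[of y]
    by (simp add: stein_sol_alt algebra_simps)
  show ?thesis
    using *[of w] *[of y] times_stein_sol_mono[of w y y] by linarith
qed

text \<open>The two bounds on \<open>w * stein_sol y w\<close> place the derivative in [0, 1] left
  of y and in [-1, 0] from y on.\<close>

lemma stein_der_bound: "\<bar>stein_der y w\<bar> \<le> 1"
proof (cases "w < y")
  case True
  then show ?thesis using times_stein_sol_ge[where y=y and w=w] times_stein_sol_le[where y=y and w=w]
    by (auto simp: stein_der_def)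
next
  case False
  then show ?thesis using times_stein_sol_ge[where y=y and w=w] times_stein_sol_le[where y=y and w=w]
    by (auto simp: stein_der_def)
qed

lemma stein_sol_deriv:
  assumes "w \<noteq> y" shows "(stein_sol y has_real_derivative stein_der y w) (at w)"
proof (cases "w < y")
  case True
  have "((\<lambda>w. mills w * (1 - Phi y)) has_real_derivative stein_der y w) (at w)"
    using True by (auto intro!: derivative_eq_intros mills_deriv simp: stein_der_def stein_sol_def algebra_simps)
  then show ?thesis
    by (rule has_field_derivative_transform_within_open[of _ _ _ "{..<y}"]) (use True in \<open>auto simp: stein_sol_def\<close>)
next
  case False
  have "((\<lambda>w. Phi y * mills (- w)) has_real_derivative stein_der y w) (at w)"
    using False assms
    by (auto intro!: derivative_eq_intros mills_deriv[THEN DERIV_chain2] simp: stein_der_def stein_sol_def algebra_simps)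
  then show ?thesis
    by (rule has_field_derivative_transform_within_open[of _ _ _ "{y<..}"])
      (use False assms in \<open>auto simp: stein_sol_def\<close>)
qed

lemma stein_sol_continuous: "continuous_on UNIV (stein_sol y)"
proof -
  have "continuous_on ({..y} \<union> {y..}) (\<lambda>w. if w \<le> y then mills w * (1 - Phi y) else Phi y * mills (- w))"
  proof (rule continuous_on_cases)
    have m: "continuous_on UNIV mills" by (simp add: continuous_at_imp_continuous_on)
    show "continuous_on {..y} (\<lambda>w. mills w * (1 - Phi y))"
      by (intro continuous_intros continuous_on_subset[OF m]) simp
    show "continuous_on {y..} (\<lambda>w. Phi y * mills (- w))"
      by (intro continuous_intros continuous_on_compose2[OF m]) simp
  qed (auto simp: stein_sol_glue)
  moreover have "{..y} \<union> {y..} = UNIV" by auto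
  ultimately show ?thesis by (simp add: stein_sol_def[abs_def])
qed

section \<open>The uniform law on the unit interval: integrals along segments and averages over
  windows\<close>

definition unif01 :: "real measure" where
  "unif01 = density lborel (indicator {0..1})"

lemma sets_unif01 [measurable_cong, simp]: "sets unif01 = sets borel"
  by (simp add: unif01_def)

lemma space_unif01 [simp]: "space unif01 = UNIV"
  by (simp add: unif01_def)

interpretation unif01: prob_space unif01
  by standard (simp add: unif01_def emeasure_density)

lemma integral_unif01:
  fixes f :: "real \<Rightarrow> real"
  assumes [measurable]: "f \<in> borel_measurable borel" and b: "\<And>x. \<bar>f x\<bar> \<le> B"
  shows "f integrable_on {0..1}" "(\<integral>x. f x \<partial>unif01) = integral {0..1} f"
proof -
  have i: "set_integrable lborel {0..1} f"
    unfolding set_integrable_def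
    by (rule integrableI_bounded_set_indicator[where B=B]) (use b in auto)
  show "f integrable_on {0..1}"
    using set_borel_integral_eq_integral(1)[OF i] .
  have "(\<integral>x. f x \<partial>unif01) = (LBINT x:{0..1}. f x)"
    unfolding unif01_def set_lebesgue_integral_def ennreal_indicator[symmetric]
    by (subst integral_density) auto
  also have "\<dots> = integral {0..1} f"
    using set_borel_integral_eq_integral(2)[OF i] .
  finally show "(\<integral>x. f x \<partial>unif01) = integral {0..1} f" .
qed

lemma integral_unif01_affine:
  fixes f :: "real \<Rightarrow> real"
  assumes [measurable]: "f \<in> borel_measurable borel" and b: "\<And>x. \<bar>f x\<bar> \<le> B" and d: "d > 0"
  shows "f integrable_on {a..a + d}" "(\<integral>t. f (a + d * t) \<partial>unif01) = integral {a..a + d} f / d"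
proof -
  have i: "set_integrable lborel {a..a + d} f"
    unfolding set_integrable_def
    by (rule integrableI_bounded_set_indicator[where B=B]) (use b in \<open>auto simp: emeasure_lborel_Icc_eq\<close>)
  show "f integrable_on {a..a + d}"
    using set_borel_integral_eq_integral(1)[OF i] .
  then have "(f has_integral integral {a..a + d} f) (cbox a (a + d))"
    by (simp add: integrable_integral)
  from has_integral_affinity[OF this, of d a]
  have "((\<lambda>x. f (d * x + a)) has_integral inverse d *\<^sub>R integral {a..a + d} f) ((\<lambda>x. inverse d *\<^sub>R x + - (inverse d *\<^sub>R a)) ` cbox a (a + d))"
    using d by (simp add: divide_inverse mult.commute)
  also have "(\<lambda>x. inverse d *\<^sub>R x + - (inverse d *\<^sub>R a)) ` cbox a (a + d) = {0..1}"
    using d image_affinity_cbox[of "inverse d" "- (inverse d *\<^sub>R a)" a "a + d"] by (auto simp: field_simps)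
  finally have "integral {0..1} (\<lambda>x. f (a + d * x)) = integral {a..a + d} f / d"
    by (auto dest!: integral_unique simp: add.commute divide_inverse mult.commute)
  moreover have "(\<integral>t. f (a + d * t) \<partial>unif01) = integral {0..1} (\<lambda>x. f (a + d * x))"
    by (rule integral_unif01(2)[where B=B]) (use b in auto)
  ultimately show "(\<integral>t. f (a + d * t) \<partial>unif01) = integral {a..a + d} f / d" by simp
qed

text \<open>The fundamental theorem along the segment from s to s + x, with finitely many points
  exempt because \<open>stein_sol y\<close> has a kink. In this form the uniform factor of the
  zero-bias law appears by itself.\<close>

lemma unif01_ftc:
  fixes f f' :: "real \<Rightarrow> real"
  assumes c: "continuous_on UNIV f" and S: "finite S"
    and d: "\<And>w. w \<notin> S \<Longrightarrow> (f has_real_derivative f' w) (at w)"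
    and [measurable]: "f' \<in> borel_measurable borel" and b: "\<And>w. \<bar>f' w\<bar> \<le> B"
  shows "f (s + x) - f s = x * (\<integral>t. f' (s + x * t) \<partial>unif01)"
proof (cases "x = 0")
  case False
  have "((\<lambda>t. x * f' (s + x * t)) has_integral f (s + x * 1) - f (s + x * 0)) {0..1}"
  proof (rule fundamental_theorem_of_calculus_interior_strong[where S="(\<lambda>w. (w - s) / x) ` S"])
    show "continuous_on {0..1} (\<lambda>t. f (s + x * t))"
      by (intro continuous_on_compose2[OF c] continuous_intros) auto
    fix t assume "t \<in> {0<..<1} - (\<lambda>w. (w - s) / x) ` S"
    then have "s + x * t \<notin> S" using False by (force simp: image_iff)
    then have "((\<lambda>t. f (s + x * t)) has_real_derivative f' (s + x * t) * x) (at t)"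
      by (intro DERIV_chain2[where g = "\<lambda>t. s + x * t"] d) (auto intro!: derivative_eq_intros)
    then show "((\<lambda>t. f (s + x * t)) has_vector_derivative x * f' (s + x * t)) (at t)"
      by (simp add: has_real_derivative_iff_has_vector_derivative mult.commute)
  qed (use S in auto)
  from integral_unique[OF this]
  have "f (s + x) - f s = integral {0..1} (\<lambda>t. x * f' (s + x * t))" by simp
  also have "\<dots> = x * (\<integral>t. f' (s + x * t) \<partial>unif01)"
    by (subst integral_unif01(2)[where B=B]) (use b in auto)
  finally show ?thesis .
qed simp

subsection \<open>Normal approximation from a zero-bias identity\<close>

lemma AE_unif01: "AE t in unif01. 0 \<le> t \<and> t \<le> 1"
  unfolding unif01_def by (subst AE_density) (auto simp: indicator_def)

lemma integrable_unif01_id: "integrable unif01 (\<lambda>t. t)"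
  by (rule unif01.integrable_const_bound[where B=1]) (use AE_unif01 in auto)

lemma unif01_mean: "(\<integral>t. t \<partial>unif01) = 1/2"
proof -
  have "(\<integral>t. t \<partial>unif01) = (\<integral>t. t ^ 1 * indicator {0..1} t \<partial>lborel)"
    unfolding unif01_def ennreal_indicator[symmetric]
    by (subst integral_density) (auto simp: mult.commute)
  then show ?thesis by (simp only: integral_power) simp
qed

lemma (in real_distribution) integrable_bounded:
  fixes f :: "real \<Rightarrow> real"
  assumes "f \<in> borel_measurable borel" "\<And>x. \<bar>f x\<bar> \<le> B"
  shows "integrable M f"
  using assms by (intro integrable_const_bound[where B=B]) auto

text \<open>\<open>mu\<close> is the law of S and \<open>rho\<close> that of the independent shift
  U. The class of test functions is chosen to contain the Stein solution (one kink) and the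
  truncated identity (two kinks); the identity itself is unbounded and excluded.\<close>

locale zero_bias = mu: real_distribution mu + rho: real_distribution rho
  for mu rho :: "real measure" +
  assumes integrable_id: "integrable mu (\<lambda>s. s)"
    and zero_bias: "\<And>f f' S B B'. \<lbrakk>continuous_on UNIV f; finite S;
      \<And>w. w \<notin> S \<Longrightarrow> (f has_real_derivative f' w) (at w); f' \<in> borel_measurable borel;
      \<And>w. \<bar>f w\<bar> \<le> B; \<And>w. \<bar>f' w\<bar> \<le> B'\<rbrakk> \<Longrightarrow>
      (\<integral>s. s * f s \<partial>mu) = (\<integral>u. (\<integral>s. f' (s + u) \<partial>mu) \<partial>rho)"
begin

text \<open>With f the identity, the zero-bias identity would give E S^2 = 1. Clipping f at -n and n
  makes it admissible and gives E S f(S) <= 1; then 2 min(|s|, n) <= 1 + s f(s), and n tends to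
  infinity.\<close>

lemma abs_moment_le: "(\<integral>s. \<bar>s\<bar> \<partial>mu) \<le> 1"
proof -
  have trunc: "(\<integral>s. min \<bar>s\<bar> (real n) \<partial>mu) \<le> 1" for n
  proof -
    define f where "f s = max (- real n) (min (real n) s)" for s
    define f' :: "real \<Rightarrow> real" where "f' = indicator {- real n<..<real n}"
    have [measurable]: "f \<in> borel_measurable borel" by (simp add: f_def[abs_def])
    have "(\<integral>s. s * f s \<partial>mu) = (\<integral>u. (\<integral>s. f' (s + u) \<partial>mu) \<partial>rho)"
    proof (rule zero_bias[where B="real n" and B'=1 and S="{- real n, real n}"])
      show "(f has_real_derivative f' w) (at w)" if w: "w \<notin> {- real n, real n}" for w
      proof -
        have "((\<lambda>_. - real n) has_real_derivative 0) (at w)" "((\<lambda>_. real n) has_real_derivative 0) (at w)"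
          "((\<lambda>s. s) has_real_derivative 1) (at w)"
          by (auto intro: derivative_eq_intros)
        note d = this[THEN has_field_derivative_transform_within_open]
        consider "w < - real n" | "w > real n" | "w \<in> {- real n<..<real n}" using w
          by (cases w "real n" rule: linorder_cases; cases w "- real n" rule: linorder_cases) auto
        then show ?thesis
          by cases
            (use d(1)[of "{..<- real n}" f] d(2)[of "{real n<..}" f] d(3)[of "{- real n<..<real n}" f]
              in \<open>auto simp: f_def f'_def\<close>)
      qed
      show "continuous_on UNIV f" unfolding f_def by (intro continuous_intros)
    qed (auto simp: f_def f'_def indicator_def)
    also have "\<dots> \<le> (\<integral>u. 1 \<partial>rho)"
    proof (rule integral_mono')
      show "(\<integral>s. f' (s + u) \<partial>mu) \<le> 1" for u
        by (rule mu.integral_le_const[OF mu.integrable_bounded[where B=1]]) (auto simp: f'_def indicator_def)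
    qed auto
    finally have le: "(\<integral>s. s * f s \<partial>mu) \<le> 1" using rho.prob_space by simp
    have i: "integrable mu (\<lambda>s. s * f s)"
      by (rule Bochner_Integration.integrable_bound[OF integrable_mult_right[OF integrable_abs[OF integrable_id], of "real n"]])
        (auto simp: f_def abs_mult intro!: AE_I2 mult_left_mono simp: mult.commute)
    have "min \<bar>s\<bar> (real n) \<le> (1 + s * f s) / 2" for s
    proof (cases "\<bar>s\<bar> \<le> real n")
      case True
      then have "f s = s" by (auto simp: f_def)
      moreover have "2 * \<bar>s\<bar> \<le> 1 + s * s"
        using zero_le_power2[of "\<bar>s\<bar> - 1"] by (simp add: power2_eq_square algebra_simps)
      ultimately show ?thesis using True by simp
    next
      case False
      then have "s * f s = \<bar>s\<bar> * real n" by (auto simp: f_def abs_if min_def max_def)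
      moreover have "\<bar>s\<bar> * real n \<ge> real n * real n" using False by (intro mult_right_mono) auto
      moreover have "real n * real n \<ge> 2 * real n - 1"
        using zero_le_power2[of "real n - 1"] by (simp add: power2_eq_square algebra_simps)
      ultimately show ?thesis using False by simp
    qed
    then have "(\<integral>s. min \<bar>s\<bar> (real n) \<partial>mu) \<le> (\<integral>s. (1 + s * f s) / 2 \<partial>mu)"
    proof (intro integral_mono)
      show "integrable mu (\<lambda>s. min \<bar>s\<bar> (real n))"
        by (rule mu.integrable_bounded[where B="real n"]) auto
    qed (auto simp: i)
    also have "\<dots> = (1 + (\<integral>s. s * f s \<partial>mu)) / 2"
      using i mu.prob_space by simp
    finally show ?thesis using le by simp
  qed
  have "(\<lambda>n. \<integral>s. min \<bar>s\<bar> (real n) \<partial>mu) \<longlonglongrightarrow> (\<integral>s. \<bar>s\<bar> \<partial>mu)"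
  proof (rule integral_dominated_convergence[where w="\<lambda>s. \<bar>s\<bar>"])
    have "(\<lambda>n. min \<bar>s\<bar> (real n)) \<longlonglongrightarrow> \<bar>s\<bar>" for s :: real
    proof (rule tendsto_eventually)
      show "\<forall>\<^sub>F n in sequentially. min \<bar>s\<bar> (real n) = \<bar>s\<bar>"
        using eventually_ge_at_top[of "nat \<lceil>\<bar>s\<bar>\<rceil>"]
        by eventually_elim (simp add: nat_ceiling_le_eq min_absorb1)
    qed
    then show "AE s in mu. (\<lambda>n. min \<bar>s\<bar> (real n)) \<longlonglongrightarrow> \<bar>s\<bar>" by simp
    show "integrable mu (\<lambda>s. \<bar>s\<bar>)" by (rule integrable_abs[OF integrable_id])
  qed (simp_all add: integrable_id)
  then show ?thesis
    by (rule LIMSEQ_le_const2) (use trunc in auto)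
qed

section \<open>The discrepancy as a mixture over the shift u, and its smoothing in the endpoint
  y\<close>

definition G :: "real \<Rightarrow> real" where "G y = measure mu {..<y}"

definition K :: "real \<Rightarrow> real \<Rightarrow> real" where
  "K y u = (\<integral>s. (s * stein_sol y s - (s + u) * stein_sol y (s + u)) \<partial>mu)"

lemma G_mono: "x \<le> y \<Longrightarrow> G x \<le> G y"
  unfolding G_def by (intro mu.finite_measure_mono) auto

lemma G_bounds: "0 \<le> G y" "G y \<le> 1"
  by (auto simp: G_def)

lemma G_measurable [measurable]: "G \<in> borel_measurable borel"
  by (rule borel_measurable_mono) (simp add: mono_def G_mono)

lemma K_measurable [measurable]: "(\<lambda>(y, u). K y u) \<in> borel_measurable (borel \<Otimes>\<^sub>M borel)"
  unfolding K_def[abs_def] by measurable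

lemma times_stein_sol_abs: "\<bar>w * stein_sol y w\<bar> \<le> 1"
  using times_stein_sol_ge[where y=y and w=w] times_stein_sol_le[where y=y and w=w] Phi_nonneg[of y] Phi_le_1[of y] by linarith

lemma integrable_g: "integrable mu (\<lambda>s. (s + u) * stein_sol y (s + u))" "integrable mu (\<lambda>s. s * stein_sol y s)"
  by (rule mu.integrable_bounded[where B=1]; simp add: times_stein_sol_abs)+

lemma stein_sol_lipschitz: "\<bar>stein_sol y (s + u) - stein_sol y s\<bar> \<le> \<bar>u\<bar>"
proof -
  have "stein_sol y (s + u) - stein_sol y s = u * (\<integral>t. stein_der y (s + u * t) \<partial>unif01)"
    by (rule unif01_ftc[where S="{y}" and B=1])
      (auto intro: stein_sol_continuous stein_sol_deriv stein_der_bound)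
  moreover have "\<bar>\<integral>t. stein_der y (s + u * t) \<partial>unif01\<bar> \<le> 1"
  proof -
    have "norm (\<integral>t. stein_der y (s + u * t) \<partial>unif01) \<le> (\<integral>t. 1 \<partial>unif01)"
      by (rule Bochner_Integration.integral_norm_bound_integral) 
        (auto intro!: unif01.integrable_const_bound[where B=1] simp: stein_der_bound)
    then show ?thesis using unif01.prob_space by simp
  qed
  ultimately show ?thesis
    by (simp add: abs_mult mult_left_le)
qed

text \<open>The bound 1 is the length of the range of \<open>w * stein_sol y w\<close>. For the
  linear bound the difference is, up to sign, s (f(s + u) - f(s)) + u f(s + u), where f is
  1-Lipschitz, E|S| <= 1 and f <= sqrt(2 pi) / 2.\<close>

lemma K_abs_le: "\<bar>K y u\<bar> \<le> min 1 ((1 + sqrt (2 * pi) / 2) * \<bar>u\<bar>)"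
proof -
  have i: "integrable mu (\<lambda>s. \<bar>s\<bar> * \<bar>u\<bar> + sqrt (2 * pi) / 2 * \<bar>u\<bar>)"
    using integrable_id by simp
  have "\<bar>K y u\<bar> \<le> 1"
  proof -
    have "\<bar>s * stein_sol y s - (s + u) * stein_sol y (s + u)\<bar> \<le> 1" for s
      using times_stein_sol_ge[of y s] times_stein_sol_le[of s y]
        times_stein_sol_ge[of y "s + u"] times_stein_sol_le[of "s + u" y] by linarith
    then have "norm (K y u) \<le> (\<integral>s. 1 \<partial>mu)"
      unfolding K_def by (intro Bochner_Integration.integral_norm_bound_integral) (auto intro!: integrable_g)
    then show ?thesis using mu.prob_space by simp
  qed
  moreover have "\<bar>K y u\<bar> \<le> (1 + sqrt (2 * pi) / 2) * \<bar>u\<bar>"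
  proof -
    have "\<bar>s * stein_sol y s - (s + u) * stein_sol y (s + u)\<bar> \<le> \<bar>s\<bar> * \<bar>u\<bar> + sqrt (2 * pi) / 2 * \<bar>u\<bar>" for s
    proof -
      have "\<bar>s * stein_sol y s - (s + u) * stein_sol y (s + u)\<bar>
        = \<bar>s * (stein_sol y (s + u) - stein_sol y s) + u * stein_sol y (s + u)\<bar>"
        by (simp add: algebra_simps abs_minus_commute)
      also have "\<dots> \<le> \<bar>s\<bar> * \<bar>stein_sol y (s + u) - stein_sol y s\<bar> + \<bar>u\<bar> * \<bar>stein_sol y (s + u)\<bar>"
        by (metis abs_mult abs_triangle_ineq)
      also have "\<dots> \<le> \<bar>s\<bar> * \<bar>u\<bar> + \<bar>u\<bar> * (sqrt (2 * pi) / 2)"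
        using stein_sol_nonneg[of y "s + u"] stein_sol_le[of y "s + u"]
        by (intro add_mono mult_left_mono stein_sol_lipschitz) auto
      finally show ?thesis by (simp add: mult.commute)
    qed
    then have "norm (K y u) \<le> (\<integral>s. \<bar>s\<bar> * \<bar>u\<bar> + sqrt (2 * pi) / 2 * \<bar>u\<bar> \<partial>mu)"
      unfolding K_def
      by (intro Bochner_Integration.integral_norm_bound_integral Bochner_Integration.integrable_diff integrable_g i)
        auto
    also have "\<dots> = (\<integral>s. \<bar>s\<bar> \<partial>mu) * \<bar>u\<bar> + sqrt (2 * pi) / 2 * \<bar>u\<bar>"
      using integrable_id mu.prob_space by simp
    also have "\<dots> \<le> 1 * \<bar>u\<bar> + sqrt (2 * pi) / 2 * \<bar>u\<bar>"
      by (intro add_right_mono mult_right_mono abs_moment_le) auto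
    finally show ?thesis by (simp add: algebra_simps)
  qed
  ultimately show ?thesis by simp
qed

lemma K_sign: "u \<ge> 0 \<Longrightarrow> K y u \<le> 0" "u \<le> 0 \<Longrightarrow> K y u \<ge> 0"
proof -
  assume "u \<ge> 0"
  then have "s * stein_sol y s - (s + u) * stein_sol y (s + u) \<le> 0" for s
    using times_stein_sol_mono[of s "s + u" y] by simp
  then have "- K y u \<ge> 0"
    unfolding K_def integral_minus[symmetric] by (intro integral_nonneg_AE) auto
  then show "K y u \<le> 0" by simp
next
  assume "u \<le> 0"
  then have "s * stein_sol y s - (s + u) * stein_sol y (s + u) \<ge> 0" for s
    using times_stein_sol_mono[of "s + u" s y] by simp
  then show "K y u \<ge> 0"
    unfolding K_def by (intro integral_nonneg_AE) auto
qed

text \<open>The Stein equation and the zero-bias identity write the discrepancy as E f'(S) - E f'(S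
  + U). Expanding both derivatives by the equation cancels \<open>Phi y\<close> and leaves the two
  increments.\<close>

lemma discrepancy_eq:
  "G y - Phi y = (\<integral>u. K y u + (G y - G (y - u)) \<partial>rho)"
proof -
  have i0: "integrable mu (stein_der y)"
    by (rule mu.integrable_bounded[where B=1]) (auto simp: stein_der_bound)
  have i: "integrable mu (\<lambda>s. stein_der y (s + u))" for u
    by (rule mu.integrable_bounded[where B=1]) (auto simp: stein_der_bound)
  have ind: "(\<integral>s. indicator {..<y} (s + u) \<partial>mu) = G (y - u)"
    and ii: "integrable mu (\<lambda>s. indicator {..<y} (s + u) :: real)" for u
  proof -
    have *: "(\<lambda>s. indicator {..<y} (s + u) :: real) = indicator {..<y - u}"
      by (auto simp: fun_eq_iff indicator_def)
    show "(\<integral>s. indicator {..<y} (s + u) \<partial>mu) = G (y - u)" unfolding * by (simp add: G_def)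
    show "integrable mu (\<lambda>s. indicator {..<y} (s + u) :: real)"
      by (rule mu.integrable_bounded[where B=1]) (auto simp: indicator_def)
  qed
  have der: "(\<integral>s. stein_der y (s + u) \<partial>mu)
    = (\<integral>s. (s + u) * stein_sol y (s + u) \<partial>mu) + G (y - u) - Phi y" for u
    using integrable_g ii[of u] ind[of u] mu.prob_space by (simp add: stein_der_def)
  have R: "(\<integral>s. stein_der y s \<partial>mu) - (\<integral>s. stein_der y (s + u) \<partial>mu) = K y u + (G y - G (y - u))" for u
    using der[of u] der[of 0] integrable_g by (simp add: K_def)
  have "(\<integral>s. s * stein_sol y s \<partial>mu) = (\<integral>u. (\<integral>s. stein_der y (s + u) \<partial>mu) \<partial>rho)"
    by (rule zero_bias[where S="{y}" and B="sqrt (2 * pi) / 2" and B'=1])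
      (use stein_sol_nonneg stein_sol_le in
        \<open>auto intro!: stein_sol_continuous stein_sol_deriv stein_der_bound stein_der_measurable1 simp only: abs_of_nonneg\<close>)
  moreover have "(\<integral>s. s * stein_sol y s \<partial>mu) = (\<integral>s. stein_der y s \<partial>mu) - (G y - Phi y)"
    using der[of 0] by simp
  ultimately have "G y - Phi y = (\<integral>s. stein_der y s \<partial>mu) - (\<integral>u. (\<integral>s. stein_der y (s + u) \<partial>mu) \<partial>rho)"
    by simp
  also have "\<dots> = (\<integral>u. (\<integral>s. stein_der y s \<partial>mu) - (\<integral>s. stein_der y (s + u) \<partial>mu) \<partial>rho)"
  proof (subst Bochner_Integration.integral_diff)
    show "integrable rho (\<lambda>u. \<integral>s. stein_der y (s + u) \<partial>mu)"
    proof (rule rho.integrable_bounded[where B=1])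
      fix u
      have "norm (\<integral>s. stein_der y (s + u) \<partial>mu) \<le> (\<integral>s. 1 \<partial>mu)"
        by (intro Bochner_Integration.integral_norm_bound_integral i) (auto simp: stein_der_bound)
      then show "\<bar>\<integral>s. stein_der y (s + u) \<partial>mu\<bar> \<le> 1" using mu.prob_space by simp
    qed measurable
  qed (use rho.prob_space in auto)
  finally show ?thesis by (simp add: R)
qed

text \<open>Averaging exchanges the roles of d and u: the mean over a window of length d of
  increments over distance u is 1/d times the integral over a window of length u of increments over
  distance d. Each of the latter is at most the increment of \<open>Phi\<close> plus 2
  \<Delta>.\<close>

lemma G_average:
  assumes D: "\<And>y. \<bar>G y - Phi y\<bar> \<le> \<Delta>" and d: "d > 0" and u: "u \<ge> 0"
  shows "(\<integral>t. G (a + d * t) - G (a + d * t - u) \<partial>unif01) \<in> {0..min 1 ((1 / sqrt (2 * pi) + 2 * \<Delta> / d) * u)}"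
proof -
  have b: "\<bar>G (y - v)\<bar> \<le> 1" for y v using G_bounds[of "y - v"] by simp
  have b': "\<bar>G (a + d * t) - G (a + d * t - u)\<bar> \<le> 1" for t
    using G_bounds[of "a + d * t - u"] G_bounds[of "a + d * t"] by linarith
  have int: "G integrable_on {p..q}" for p q
    by (rule integrable_on_mono_on) (simp add: mono_on_def G_mono)
  have shift: "(\<lambda>y. G (y + d)) integrable_on {p..q}" for p q
    by (rule integrable_on_mono_on) (simp add: mono_on_def G_mono)
  have iU: "integrable unif01 (\<lambda>t. G (a + d * t - v))" for v
    by (rule unif01.integrable_const_bound[where B=1]) (use b[of "a + d * _" v] in auto)
  have "(\<integral>t. G (a + d * t) - G (a + d * t - u) \<partial>unif01)
      = (\<integral>t. G (a + d * t) \<partial>unif01) - (\<integral>t. G ((a - u) + d * t) \<partial>unif01)"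
    using iU[of u] iU[of 0] by (simp add: algebra_simps)
  also have "\<dots> = (integral {a..a + d} G - integral {a - u..a - u + d} G) / d"
    using integral_unif01_affine(2)[OF G_measurable _ d, where B=1 and a=a] b[of _ 0]
      integral_unif01_affine(2)[OF G_measurable _ d, where B=1 and a="a - u"]
    by (simp add: diff_divide_distrib)
  \<comment> \<open>Both windows are completed to [a - u, a + d]; the common integral cancels,
    whether or not the windows overlap.\<close>
  also have "integral {a..a + d} G - integral {a - u..a - u + d} G
      = integral {a - u + d..a + d} G - integral {a - u..a} G"
    using Henstock_Kurzweil_Integration.integral_combine[OF _ _ int, of "a - u" a "a + d"]
      Henstock_Kurzweil_Integration.integral_combine[OF _ _ int, of "a - u" "a - u + d" "a + d"] d u by simp
  also have "integral {a - u + d..a + d} G = integral {a - u..a} (\<lambda>y. G (y + d))"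
    using has_integral_affinity'[of G "integral {a - u + d..a + d} G" "a - u + d" "a + d" 1 d] int
    by (simp add: integrable_integral integral_unique)
  also have "\<dots> - integral {a - u..a} G = integral {a - u..a} (\<lambda>y. G (y + d) - G y)"
    by (rule Henstock_Kurzweil_Integration.integral_diff[symmetric]) (rule shift int)+
  also have "\<dots> \<le> integral {a - u..a} (\<lambda>y. d / sqrt (2 * pi) + 2 * \<Delta>)"
  proof (rule integral_le)
    fix y
    show "G (y + d) - G y \<le> d / sqrt (2 * pi) + 2 * \<Delta>"
      using D[of y] D[of "y + d"] Phi_lipschitz[of y "y + d"] d by (simp add: abs_le_iff)
  qed (auto intro!: Henstock_Kurzweil_Integration.integrable_diff int shift)
  also have "\<dots> = u * (d / sqrt (2 * pi) + 2 * \<Delta>)" using u by simp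
  finally have "(\<integral>t. G (a + d * t) - G (a + d * t - u) \<partial>unif01) \<le> u * (d / sqrt (2 * pi) + 2 * \<Delta>) / d"
    using d by (simp add: divide_right_mono)
  also have "\<dots> = (1 / sqrt (2 * pi) + 2 * \<Delta> / d) * u"
    using d by (simp add: field_simps)
  finally have 1: "(\<integral>t. G (a + d * t) - G (a + d * t - u) \<partial>unif01) \<le> (1 / sqrt (2 * pi) + 2 * \<Delta> / d) * u" .
  have 2: "(\<integral>t. G (a + d * t) - G (a + d * t - u) \<partial>unif01) \<ge> 0"
    using u by (intro integral_nonneg_AE) (auto intro!: G_mono)
  have "(\<integral>t. G (a + d * t) - G (a + d * t - u) \<partial>unif01) \<le> (\<integral>t. 1 \<partial>unif01)"
    by (rule integral_mono) (use iU[of u] iU[of 0] b' in \<open>auto simp: abs_le_iff\<close>)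
  then show ?thesis using 1 2 unif01.prob_space by simp
qed

text \<open>For u >= 0 the part from \<open>K\<close> is nonpositive and the part from
  \<open>G\<close> nonnegative, and for u <= 0 the reverse. Two numbers of opposite sign have a sum
  no larger in modulus than the larger of them, so their bounds are not added.\<close>

lemma average_bound:
  assumes D: "\<And>y. \<bar>G y - Phi y\<bar> \<le> \<Delta>" and d: "d > 0"
    and c: "c \<ge> 1 / sqrt (2 * pi) + 2 * \<Delta> / d" "c \<ge> 1 + sqrt (2 * pi) / 2"
  shows "\<bar>\<integral>t. K (a + d * t) u + (G (a + d * t) - G (a + d * t - u)) \<partial>unif01\<bar> \<le> min 1 (c * \<bar>u\<bar>)"
proof -
  let ?k = "\<integral>t. K (a + d * t) u \<partial>unif01" and ?g = "\<lambda>u a. \<integral>t. G (a + d * t) - G (a + d * t - u) \<partial>unif01"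
  have Kb: "\<bar>K y u\<bar> \<le> 1" for y using K_abs_le[of y u] by simp
  have iK: "integrable unif01 (\<lambda>t. K (a + d * t) u)"
    by (rule unif01.integrable_const_bound[where B=1]) (use Kb in auto)
  have iG: "integrable unif01 (\<lambda>t. G (a + d * t - v))" for v
    by (rule unif01.integrable_const_bound[where B=1]) (use G_bounds in auto)
  have mc: "min 1 (c' * \<bar>u\<bar>) \<le> min 1 (c * \<bar>u\<bar>)" if "c' \<le> c" for c'
    using mult_right_mono[OF that, of "\<bar>u\<bar>"] by auto
  have "norm ?k \<le> (\<integral>t. min 1 ((1 + sqrt (2 * pi) / 2) * \<bar>u\<bar>) \<partial>unif01)"
    by (rule Bochner_Integration.integral_norm_bound_integral[OF iK]) (use K_abs_le in auto)
  then have "\<bar>?k\<bar> \<le> min 1 ((1 + sqrt (2 * pi) / 2) * \<bar>u\<bar>)"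
    using unif01.prob_space by (simp del: min.bounded_iff)
  then have k: "\<bar>?k\<bar> \<le> min 1 (c * \<bar>u\<bar>)" using mc[OF c(2)] by (rule order_trans)
  have sum: "(\<integral>t. K (a + d * t) u + (G (a + d * t) - G (a + d * t - u)) \<partial>unif01) = ?k + ?g u a"
    using iK iG[of u] iG[of 0] by simp
  show ?thesis
  proof (cases "u \<ge> 0")
    case True
    have "?k \<le> 0"
    proof -
      have "(\<integral>t. - K (a + d * t) u \<partial>unif01) \<ge> 0"
        using K_sign(1)[OF True] by (intro integral_nonneg_AE) auto
      then show ?thesis by simp
    qed
    moreover have "?g u a \<in> {0..min 1 (c * \<bar>u\<bar>)}"
      using G_average[OF D d True, of a] mc[OF c(1)] True by auto
    ultimately show ?thesis using k sum by auto
  next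
    case False
    then have "u \<le> 0" by simp
    have "?k \<ge> 0"
      using K_sign(2)[OF \<open>u \<le> 0\<close>] by (intro integral_nonneg_AE) auto
    \<comment> \<open>For negative u the increment is read backwards: shift -u, window starting at a
      - u.\<close>
    moreover have "- ?g u a \<in> {0..min 1 (c * \<bar>u\<bar>)}"
      using G_average[OF D d, of "- u" "a - u"] mc[OF c(1)] False
      by (auto simp: algebra_simps simp flip: integral_minus)
    ultimately show ?thesis using k sum by auto
  qed
qed

text \<open>The linear bound needs the average in y at fixed u, so Fubini moves it inside the
  integral over u before absolute values are taken.\<close>

lemma average_discrepancy:
  assumes D: "\<And>y. \<bar>G y - Phi y\<bar> \<le> \<Delta>" and d: "d > 0"
    and c: "c \<ge> 1 / sqrt (2 * pi) + 2 * \<Delta> / d" "c \<ge> 1 + sqrt (2 * pi) / 2"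
  shows "\<bar>\<integral>t. G (a + d * t) - Phi (a + d * t) \<partial>unif01\<bar> \<le> (\<integral>u. min 1 (c * \<bar>u\<bar>) \<partial>rho)"
proof -
  interpret P: pair_prob_space rho unif01 ..
  let ?R = "\<lambda>u t. K (a + d * t) u + (G (a + d * t) - G (a + d * t - u))"
  have "\<bar>?R u t\<bar> \<le> 2" for u t
    using K_abs_le[of "a + d * t" u] G_bounds[of "a + d * t"] G_bounds[of "a + d * t - u"] by linarith
  then have i: "integrable (rho \<Otimes>\<^sub>M unif01) (case_prod ?R)"
    by (intro P.P.integrable_const_bound[where B=2]) auto
  have "(\<integral>t. G (a + d * t) - Phi (a + d * t) \<partial>unif01) = (\<integral>t. (\<integral>u. ?R u t \<partial>rho) \<partial>unif01)"
    by (simp add: discrepancy_eq)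
  also have "\<dots> = (\<integral>u. (\<integral>t. ?R u t \<partial>unif01) \<partial>rho)"
    by (rule P.Fubini_integral[OF i])
  also have "norm \<dots> \<le> (\<integral>u. min 1 (c * \<bar>u\<bar>) \<partial>rho)"
  proof (rule Bochner_Integration.integral_norm_bound_integral)
    show "integrable rho (\<lambda>u. \<integral>t. ?R u t \<partial>unif01)" by (rule P.integrable_fst'[OF i, simplified])
    have "c \<ge> 0" using c(2) by (smt (verit) pi_gt_zero real_sqrt_ge_0_iff divide_nonneg_pos)
    then show "integrable rho (\<lambda>u. min 1 (c * \<bar>u\<bar>))"
      by (intro rho.integrable_bounded[where B=1]) auto
  qed (use average_bound[OF D d c] in auto)
  finally show ?thesis by simp
qed

text \<open>\<open>G\<close> is monotone and \<open>Phi\<close> is Lipschitz, so the discrepancy at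
  x is bounded above by that at points to the right and below by that at points to the left, up to 1
  / sqrt(2 pi) times the distance. The mean distance inside the window is d / 2.\<close>

lemma smoothing:
  assumes D: "\<And>y. \<bar>G y - Phi y\<bar> \<le> \<Delta>" and d: "d > 0"
    and c: "c \<ge> 1 / sqrt (2 * pi) + 2 * \<Delta> / d" "c \<ge> 1 + sqrt (2 * pi) / 2"
  shows "\<bar>G x - Phi x\<bar> \<le> (\<integral>u. min 1 (c * \<bar>u\<bar>) \<partial>rho) + d / (2 * sqrt (2 * pi))"
proof -
  note avg = average_discrepancy[OF D d c]
  have "\<bar>G y - Phi y\<bar> \<le> 1" for y
    using G_bounds[of y] Phi_nonneg[of y] Phi_le_1[of y] by linarith
  then have iD: "integrable unif01 (\<lambda>t. G (a + d * t) - Phi (a + d * t))" for a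
    by (intro unif01.integrable_const_bound[where B=1]) auto
  have "G x - Phi x = (\<integral>t. G x - Phi x \<partial>unif01)"
    using unif01.prob_space by simp
  also have "\<dots> \<le> (\<integral>t. (G (x + d * t) - Phi (x + d * t)) + d / sqrt (2 * pi) * t \<partial>unif01)"
  proof (rule integral_mono_AE)
    show "AE t in unif01. G x - Phi x \<le> (G (x + d * t) - Phi (x + d * t)) + d / sqrt (2 * pi) * t"
      using AE_unif01
    proof eventually_elim
      case (elim t)
      then have "x \<le> x + d * t" using d by simp
      from G_mono[OF this] Phi_lipschitz[OF this] show ?case by simp
    qed
  qed (auto intro!: Bochner_Integration.integrable_add iD integrable_mult_right integrable_unif01_id)
  also have "\<dots> = (\<integral>t. G (x + d * t) - Phi (x + d * t) \<partial>unif01) + d / sqrt (2 * pi) * (1 / 2)"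
    using iD integrable_unif01_id by (subst Bochner_Integration.integral_add) (auto simp: unif01_mean)
  finally have upper: "G x - Phi x \<le> (\<integral>u. min 1 (c * \<bar>u\<bar>) \<partial>rho) + d / (2 * sqrt (2 * pi))"
    using avg[of x] by (simp add: mult.commute)
  have "(\<integral>t. (G (x - d + d * t) - Phi (x - d + d * t)) \<partial>unif01) 
    \<le> (\<integral>t. G x - Phi x + (d / sqrt (2 * pi) - d / sqrt (2 * pi) * t) \<partial>unif01)"
  proof (rule integral_mono_AE)
    show "AE t in unif01. G (x - d + d * t) - Phi (x - d + d * t)
        \<le> G x - Phi x + (d / sqrt (2 * pi) - d / sqrt (2 * pi) * t)"
      using AE_unif01
    proof eventually_elim
      case (elim t)
      then have "x - d + d * t \<le> x" using mult_left_mono[of t 1 d] d by simp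
      from G_mono[OF this] Phi_lipschitz[OF this] show ?case by (simp add: diff_divide_distrib)
    qed
  qed (intro Bochner_Integration.integrable_add Bochner_Integration.integrable_diff iD
      integrable_mult_right integrable_unif01_id unif01.integrable_const)+
  also have "\<dots> = G x - Phi x + (d / sqrt (2 * pi) - d / sqrt (2 * pi) * (1 / 2))"
    using integrable_unif01_id unif01.prob_space by (simp add: unif01_mean)
  finally have "- (G x - Phi x) \<le> (\<integral>u. min 1 (c * \<bar>u\<bar>) \<partial>rho) + d / (2 * sqrt (2 * pi))"
    using avg[of "x - d"] by (simp add: mult.commute)
  with upper show ?thesis by simp
qed

text \<open>The supremum \<Delta> is finite, so the inequality that bounds it by a multiple of
  itself can be solved. The factor \<open>max 1 (c / 2)\<close> in the hypothesis reflects the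
  uniform factor of U.\<close>

lemma discrepancy_le:
  assumes e: "e > 0" and le: "\<And>c. c \<ge> 0 \<Longrightarrow> (\<integral>u. min 1 (c * \<bar>u\<bar>) \<partial>rho) \<le> max 1 (c / 2) * e"
  shows "\<bar>measure mu {..<x} - Phi x\<bar> \<le> 1.8546 * e"
proof -
  have bdd: "\<bar>G y - Phi y\<bar> \<le> 1" for y
    using G_bounds[of y] Phi_nonneg[of y] Phi_le_1[of y] by linarith
  define \<Delta> where "\<Delta> = (SUP y. \<bar>G y - Phi y\<bar>)"
  have D: "\<bar>G y - Phi y\<bar> \<le> \<Delta>" for y
    unfolding \<Delta>_def by (rule cSUP_upper) (use bdd in \<open>auto intro!: bdd_aboveI[of _ 1]\<close>)
  have \<Delta>0: "\<Delta> \<ge> 0" using D[of 0] by linarith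
  \<comment> \<open>The crude bound pi < 4 is enough, as 2.83 squared exceeds 8.\<close>
  have "sqrt (2 * pi) \<le> sqrt (2.83\<^sup>2)"
    by (rule real_sqrt_le_mono) (use pi_less_4 in \<open>simp add: power2_eq_square\<close>)
  then have C: "2 \<le> sqrt (2 * pi)" "sqrt (2 * pi) \<le> 2.83"
    using pi_ge_two by (auto intro!: real_le_rsqrt)
  then have iC: "1 / sqrt (2 * pi) \<le> 1 / 2"
    by (intro divide_left_mono) auto
  \<comment> \<open>Here d = 2 e. The first entry bounds 1 / sqrt(2 pi) by 1/2 and contains 2
    \<Delta> / d = \<Delta> / e; the second is 1 + 2.83 / 2, the slope for \<open>K\<close>.\<close>
  define c where "c = max (1 / 2 + \<Delta> / e) 2.415"
  have c1: "c \<ge> 1 / sqrt (2 * pi) + 2 * \<Delta> / (2 * e)"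
  proof -
    have "2 * \<Delta> / (2 * e) = \<Delta> / e" by simp
    then show ?thesis using iC unfolding c_def by linarith
  qed
  have c2: "c \<ge> 1 + sqrt (2 * pi) / 2" using C(2) by (simp add: c_def)
  have c0: "c \<ge> 0" by (simp add: c_def)
  have "\<bar>G y - Phi y\<bar> \<le> max 1 (c / 2) * e + e / 2" for y
  proof -
    have "2 * e / (2 * sqrt (2 * pi)) = e * (1 / sqrt (2 * pi))" by simp
    also have "\<dots> \<le> e * (1 / 2)" using iC e by (intro mult_left_mono) auto
    finally show ?thesis
      using smoothing[OF D _ c1 c2, of y] le[OF c0] e by linarith
  qed
  then have "\<Delta> \<le> max 1 (c / 2) * e + e / 2"
    unfolding \<Delta>_def by (intro cSUP_least) auto
  \<comment> \<open>As c / 2 exceeds 1, two cases remain: \<Delta> <= 1.7075 e directly, or \<Delta>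
    <= 3 e / 4 + \<Delta> / 2, hence \<Delta> <= 1.5 e. The claimed constant leaves a
    margin.\<close>
  also have "max 1 (c / 2) * e = max (1.2075 * e) (e / 4 + \<Delta> / 2)"
    using e by (auto simp: c_def max_def field_simps)
  finally have "\<Delta> \<le> 1.8546 * e" using e by (auto simp: max_def split: if_splits)
  then show ?thesis using D[of x] by (simp add: G_def)
qed

end

subsection \<open>The zero-bias distribution\<close>

text \<open>\<open>nu\<close> is the law of one normalised summand and \<open>r\<close> the Poisson
  parameter; \<open>second_moment\<close> says that the sum has variance 1. The compound Poisson
  structure enters only through \<open>mecke\<close>.\<close>

locale poisson_stein = mu: real_distribution mu + nu: real_distribution nu
  for mu nu :: "real measure" +
  fixes r :: real
  assumes r_pos: "r > 0"
    and mean_zero: "(\<integral>x. x \<partial>nu) = 0"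
    and integrable_sq: "integrable nu (\<lambda>x. x\<^sup>2)"
    and second_moment: "r * (\<integral>x. x\<^sup>2 \<partial>nu) = 1"
    and integrable_mu: "integrable mu (\<lambda>s. s)"
    and mecke: "\<And>f B. \<lbrakk>f \<in> borel_measurable borel; \<And>s. \<bar>f s\<bar> \<le> B\<rbrakk> \<Longrightarrow>
      (\<integral>s. s * f s \<partial>mu) = r * (\<integral>s. (\<integral>x. x * f (s + x) \<partial>nu) \<partial>mu)"
begin

text \<open>The square-biased law of a summand, of total mass 1 by \<open>second_moment\<close>.
  Multiplication by an independent uniform variable turns it into the zero-bias law
  \<open>zb\<close>.\<close>

definition nu2 :: "real measure" where "nu2 = density nu (\<lambda>x. ennreal (r * x\<^sup>2))"

definition zb :: "real measure" where
  "zb = distr (nu2 \<Otimes>\<^sub>M unif01) borel (\<lambda>(x, t). x * t)"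

lemma sets_nu2 [simp, measurable_cong]: "sets nu2 = sets borel"
  by (simp add: nu2_def)

lemma integral_nu2:
  assumes "f \<in> borel_measurable borel"
  shows "(\<integral>x. f x \<partial>nu2) = r * (\<integral>x. x\<^sup>2 * f x \<partial>nu)"
  unfolding nu2_def using assms r_pos
  by (subst integral_density) (auto simp: mult.assoc)

lemma prob_space_nu2: "prob_space nu2"
proof
  have "emeasure nu2 (space nu2) = (\<integral>\<^sup>+x. ennreal (r * x\<^sup>2) \<partial>nu)"
    by (auto simp: nu2_def emeasure_density intro!: nn_integral_cong)
  also have "\<dots> = ennreal (\<integral>x. r * x\<^sup>2 \<partial>nu)"
    using integrable_sq r_pos by (intro nn_integral_eq_integral) auto
  also have "\<dots> = 1" using second_moment by simp
  finally show "emeasure nu2 (space nu2) = 1" .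
qed

sublocale nu2: real_distribution nu2
  by (simp add: real_distribution_def real_distribution_axioms_def prob_space_nu2)

sublocale P: pair_prob_space nu2 unif01 ..

sublocale zb: real_distribution zb
proof -
  have "prob_space zb" unfolding zb_def by (rule P.prob_space_distr) measurable
  then show "real_distribution zb"
    by (simp add: real_distribution_def real_distribution_axioms_def zb_def)
qed

lemma integral_zb:
  fixes F :: "real \<Rightarrow> real"
  assumes [measurable]: "F \<in> borel_measurable borel" and b: "\<And>u. \<bar>F u\<bar> \<le> B"
  shows "(\<integral>u. F u \<partial>zb) = r * (\<integral>x. x\<^sup>2 * (\<integral>t. F (x * t) \<partial>unif01) \<partial>nu)"
proof -
  have "(\<integral>u. F u \<partial>zb) = (\<integral>p. F (fst p * snd p) \<partial>(nu2 \<Otimes>\<^sub>M unif01))"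
    unfolding zb_def by (subst integral_distr) (auto simp: case_prod_beta)
  also have "\<dots> = (\<integral>x. (\<integral>t. F (x * t) \<partial>unif01) \<partial>nu2)"
    by (subst P.integral_fst'[symmetric]) (auto intro!: P.integrable_const_bound[where B=B] simp: b)
  also have "\<dots> = r * (\<integral>x. x\<^sup>2 * (\<integral>t. F (x * t) \<partial>unif01) \<partial>nu)"
    by (rule integral_nu2) measurable
  finally show ?thesis .
qed

lemma integrable_nu: "integrable nu (\<lambda>x. x)"
  by (rule nu.square_integrable_imp_integrable[OF _ integrable_sq]) auto

text \<open>As x has mean zero under \<open>nu\<close>, x f(s + x) may be replaced by x (f(s + x) -
  f(s)), which is x^2 times the uniform average of f' along the segment. Weighted by r, this is the
  integral against \<open>zb\<close>; \<open>mecke\<close> then supplies the outer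
  expectation.\<close>

sublocale zero_bias mu zb
proof
  fix f f' :: "real \<Rightarrow> real" and S B B'
  assume c: "continuous_on UNIV f" and S: "finite S"
    and d: "\<And>w. w \<notin> S \<Longrightarrow> (f has_real_derivative f' w) (at w)"
    and f': "f' \<in> borel_measurable borel"
    and fB: "\<And>w. \<bar>f w\<bar> \<le> B" and B': "\<And>w. \<bar>f' w\<bar> \<le> B'"
  note [measurable] = f'
  have [measurable]: "f \<in> borel_measurable borel"
    using c by (rule borel_measurable_continuous_onI)
  have i: "integrable nu (\<lambda>x. x * f (s + x))" for s
    by (rule Bochner_Integration.integrable_bound[OF integrable_mult_right[OF integrable_abs[OF integrable_nu], of B]])
      (use fB in \<open>auto simp: abs_mult mult.commute intro!: AE_I2 mult_left_mono order_trans[OF fB abs_ge_self]\<close>)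
  have "r * (\<integral>x. x * f (s + x) \<partial>nu) = (\<integral>u. f' (s + u) \<partial>zb)" for s
  proof -
    have "(\<integral>x. x * f (s + x) \<partial>nu) = (\<integral>x. x * f (s + x) - x * f s \<partial>nu)"
      using i[of s] integrable_nu mean_zero by simp
    also have "\<dots> = (\<integral>x. x\<^sup>2 * (\<integral>t. f' (s + x * t) \<partial>unif01) \<partial>nu)"
    proof (rule Bochner_Integration.integral_cong[OF refl])
      fix x
      have "x * f (s + x) - x * f s = x * (f (s + x) - f s)" by (simp add: algebra_simps)
      also have "\<dots> = x * (x * (\<integral>t. f' (s + x * t) \<partial>unif01))"
        using unif01_ftc[OF c S d f' B', of s x] by simp
      finally show "x * f (s + x) - x * f s = x\<^sup>2 * (\<integral>t. f' (s + x * t) \<partial>unif01)"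
        by (simp add: power2_eq_square)
    qed
    finally show ?thesis
      by (subst integral_zb[where B=B']) (auto simp: B')
  qed
  note inner = this
  have "(\<integral>s. s * f s \<partial>mu) = r * (\<integral>s. (\<integral>x. x * f (s + x) \<partial>nu) \<partial>mu)"
    by (rule mecke[OF _ fB]) measurable
  also have "\<dots> = (\<integral>s. r * (\<integral>x. x * f (s + x) \<partial>nu) \<partial>mu)"
    by (rule integral_mult_right_zero[symmetric])
  also have "\<dots> = (\<integral>s. (\<integral>u. f' (s + u) \<partial>zb) \<partial>mu)"
    by (simp only: inner)
  also have "\<dots> = (\<integral>u. (\<integral>s. f' (s + u) \<partial>mu) \<partial>zb)"
  proof -
    interpret Q: pair_prob_space zb mu ..
    show ?thesis
      by (rule Q.Fubini_integral) (auto intro!: Q.P.integrable_const_bound[where B=B'] simp: B')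
  qed
  finally show "(\<integral>s. s * f s \<partial>mu) = (\<integral>u. (\<integral>s. f' (s + u) \<partial>mu) \<partial>zb)" .
qed (rule integrable_mu)

lemma integrable_min: "integrable nu (\<lambda>x. x\<^sup>2 * min 1 \<bar>x\<bar>)"
  by (rule Bochner_Integration.integrable_bound[OF integrable_sq])
    (auto intro!: AE_I2 mult_left_le simp: abs_mult)

text \<open>For fixed x, averaging over the uniform factor t gives at most 1 and at most c |x| / 2;
  the first is used for |x| > 1, the second otherwise.\<close>

lemma zb_truncated_le:
  assumes c: "c \<ge> 0"
  shows "(\<integral>u. min 1 (c * \<bar>u\<bar>) \<partial>zb) \<le> max 1 (c / 2) * (r * (\<integral>x. x\<^sup>2 * min 1 \<bar>x\<bar> \<partial>nu))"
proof -
  have inner: "(\<integral>t. min 1 (c * \<bar>x * t\<bar>) \<partial>unif01) \<le> max 1 (c / 2) * min 1 \<bar>x\<bar>" for x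
  proof -
    have i: "integrable unif01 (\<lambda>t. min 1 (c * \<bar>x * t\<bar>))"
      by (rule unif01.integrable_const_bound[where B=1]) (use c in auto)
    have "(\<integral>t. min 1 (c * \<bar>x * t\<bar>) \<partial>unif01) \<le> (\<integral>t. 1 \<partial>unif01)"
      by (rule integral_mono[OF i]) auto
    then have 1: "(\<integral>t. min 1 (c * \<bar>x * t\<bar>) \<partial>unif01) \<le> 1" using unif01.prob_space by simp
    have "(\<integral>t. min 1 (c * \<bar>x * t\<bar>) \<partial>unif01) \<le> (\<integral>t. c * \<bar>x\<bar> * t \<partial>unif01)"
    proof (rule integral_mono_AE[OF i])
      show "AE t in unif01. min 1 (c * \<bar>x * t\<bar>) \<le> c * \<bar>x\<bar> * t"
        using AE_unif01 by eventually_elim (simp add: abs_mult mult.assoc)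
    qed (rule integrable_mult_right[OF integrable_unif01_id])
    also have "\<dots> = c / 2 * \<bar>x\<bar>" using unif01_mean by simp
    finally have 2: "(\<integral>t. min 1 (c * \<bar>x * t\<bar>) \<partial>unif01) \<le> c / 2 * \<bar>x\<bar>" .
    have "c / 2 * \<bar>x\<bar> \<le> max 1 (c / 2) * \<bar>x\<bar>" by (intro mult_right_mono) auto
    moreover have "1 \<le> max 1 (c / 2)" by simp
    ultimately show ?thesis
      using 1 2 min_absorb1[of 1 "\<bar>x\<bar>"] min_absorb2[of "\<bar>x\<bar>" 1]
      by (cases "\<bar>x\<bar> \<le> 1") (metis order_trans, metis mult.right_neutral nle_le order_trans)
  qed
  have "(\<integral>u. min 1 (c * \<bar>u\<bar>) \<partial>zb) = r * (\<integral>x. x\<^sup>2 * (\<integral>t. min 1 (c * \<bar>x * t\<bar>) \<partial>unif01) \<partial>nu)"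
    by (rule integral_zb[where B=1]) (use c in auto)
  also have "\<dots> \<le> r * (\<integral>x. max 1 (c / 2) * (x\<^sup>2 * min 1 \<bar>x\<bar>) \<partial>nu)"
  proof (intro mult_left_mono integral_mono')
    show "integrable nu (\<lambda>x. max 1 (c / 2) * (x\<^sup>2 * min 1 \<bar>x\<bar>))"
      by (intro integrable_mult_right integrable_min)
    show "x\<^sup>2 * (\<integral>t. min 1 (c * \<bar>x * t\<bar>) \<partial>unif01) \<le> max 1 (c / 2) * (x\<^sup>2 * min 1 \<bar>x\<bar>)" for x
      using mult_left_mono[OF inner[of x], of "x\<^sup>2"] by (simp add: mult.left_commute)
  qed (use r_pos c in \<open>auto intro!: mult_nonneg_nonneg integral_nonneg_AE\<close>)
  finally show ?thesis by (simp only: integral_mult_right_zero mult.left_commute[of r])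
qed

text \<open>What remains is to show that the error quantity is positive: were it zero,
  \<open>nu\<close> would sit at 0, against \<open>second_moment\<close>.\<close>

lemma normal_approximation:
  "\<bar>measure mu {..<x} - Phi x\<bar> \<le> 1.8546 * (r * (\<integral>x. x\<^sup>2 * min 1 \<bar>x\<bar> \<partial>nu))"
proof (rule discrepancy_le[OF _ zb_truncated_le])
  have "(\<integral>x. x\<^sup>2 * min 1 \<bar>x\<bar> \<partial>nu) \<noteq> 0"
  proof
    assume "(\<integral>x. x\<^sup>2 * min 1 \<bar>x\<bar> \<partial>nu) = 0"
    then have "AE x in nu. x\<^sup>2 * min 1 \<bar>x\<bar> = 0"
      using integral_nonneg_eq_0_iff_AE[OF integrable_min] by simp
    moreover have "x\<^sup>2 = 0" if "x\<^sup>2 * min 1 \<bar>x\<bar> = 0" for x :: real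
    proof (rule ccontr)
      assume "x\<^sup>2 \<noteq> 0"
      then have "min 1 \<bar>x\<bar> > 0" by simp
      with that \<open>x\<^sup>2 \<noteq> 0\<close> show False by (metis less_irrefl mult_eq_0_iff)
    qed
    ultimately have "AE x in nu. x\<^sup>2 = 0" by (rule eventually_mono)
    then have "(\<integral>x. x\<^sup>2 \<partial>nu) = 0"
      by (rule integral_eq_zero_AE)
    then show False using second_moment by simp
  qed
  moreover have "(\<integral>x. x\<^sup>2 * min 1 \<bar>x\<bar> \<partial>nu) \<ge> 0" by (intro integral_nonneg_AE) auto
  ultimately show "0 < r * (\<integral>x. x\<^sup>2 * min 1 \<bar>x\<bar> \<partial>nu)"
    using r_pos by (metis less_le mult_pos_pos)
qed

end

subsection \<open>Compound Poisson sums\<close>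

text \<open>The recursion k p(k) = r p(k - 1) of the Poisson weights. At k = 0 the truncated
  subtraction is harmless because of the factor \<open>real k\<close>.\<close>

lemma poisson_shift:
  fixes h :: "nat \<Rightarrow> real"
  assumes r: "r > 0" and h: "\<And>k. \<bar>h k\<bar> \<le> B"
  shows "integrable (measure_pmf (poisson_pmf r)) (\<lambda>k. real k * h (k - 1))"
    "(\<integral>k. real k * h (k - 1) \<partial>measure_pmf (poisson_pmf r)) = r * (\<integral>k. h k \<partial>measure_pmf (poisson_pmf r))"
proof -
  let ?p = "pmf (poisson_pmf r)"
  have "integrable (measure_pmf (poisson_pmf r)) h"
    by (rule measure_pmf.integrable_const_bound[where B=B]) (use h in auto)
  then have ih: "integrable (count_space UNIV) (\<lambda>k. ?p k * h k)"
    by (simp add: measure_pmf_eq_density integrable_density)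
  then have sn: "summable (\<lambda>k. norm (?p k * h k))"
    by (simp only: integrable_count_space_nat_iff)
  let ?u = "\<lambda>k. ?p k * (real k * h (k - 1))"
  have Suc: "?u (Suc k) = r * (?p k * h k)" for k
    using r by (simp add: field_simps del: of_nat_Suc)
  have 0: "?u 0 = 0" by simp
  have "summable (\<lambda>k. norm (?u (Suc k)))"
    unfolding Suc norm_mult[of r] by (intro summable_mult sn)
  then have "summable (\<lambda>k. norm (?u k))" by (subst (asm) summable_Suc_iff)
  then have iu: "integrable (count_space UNIV) ?u"
    by (simp only: integrable_count_space_nat_iff)
  then show "integrable (measure_pmf (poisson_pmf r)) (\<lambda>k. real k * h (k - 1))"
    by (simp add: measure_pmf_eq_density integrable_density)
  have "(\<integral>k. real k * h (k - 1) \<partial>measure_pmf (poisson_pmf r)) = (\<integral>k. ?u k \<partial>count_space UNIV)"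
    by (simp add: measure_pmf_eq_density integral_density)
  also have "\<dots> = (\<Sum>k. ?u k)" by (rule integral_count_space_nat[OF iu])
  also have "\<dots> = ?u 0 + (\<Sum>k. ?u (Suc k))"
    using suminf_split_head[of ?u] iu by (simp add: integrable_count_space_nat_iff summable_norm_cancel)
  also have "\<dots> = (\<Sum>k. r * (?p k * h k))" unfolding Suc 0 by simp
  also have "\<dots> = r * (\<Sum>k. ?p k * h k)"
    by (rule suminf_mult[OF summable_norm_cancel[OF sn]])
  also have "(\<Sum>k. ?p k * h k) = (\<integral>k. ?p k * h k \<partial>count_space UNIV)"
    by (rule integral_count_space_nat[OF ih, symmetric])
  also have "\<dots> = (\<integral>k. h k \<partial>measure_pmf (poisson_pmf r))"
    by (simp add: measure_pmf_eq_density integral_density)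
  finally show "(\<integral>k. real k * h (k - 1) \<partial>measure_pmf (poisson_pmf r)) = r * (\<integral>k. h k \<partial>measure_pmf (poisson_pmf r))" .
qed

locale iid_seq = prob_space M for M :: "'a measure" +
  fixes Y :: "nat \<Rightarrow> 'a \<Rightarrow> real"
  assumes meas [measurable]: "\<And>i. Y i \<in> borel_measurable M"
    and indep: "indep_vars (\<lambda>_. borel) Y UNIV"
    and ident: "\<And>i. distr M borel (Y i) = distr M borel (Y 0)"
    and integrable_0: "integrable M (Y 0)"
begin

definition nu :: "real measure" where "nu = distr M borel (Y 0)"

definition S :: "nat \<Rightarrow> 'a \<Rightarrow> real" where "S k \<omega> = (\<Sum>i<k. Y i \<omega>)"

definition mu :: "nat \<Rightarrow> real measure" where "mu k = distr M borel (S k)"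

lemma S_measurable [measurable]: "S k \<in> borel_measurable M"
  unfolding S_def[abs_def] by measurable

sublocale nu: real_distribution nu
  unfolding nu_def by (rule real_distribution_distr) measurable

sublocale mu: real_distribution "mu k" for k
  unfolding mu_def by (rule real_distribution_distr) measurable

sublocale MN: pair_prob_space "mu k" nu for k ..

lemma integrable_nu: "integrable nu (\<lambda>x. x)"
  unfolding nu_def using integrable_0 by (simp add: integrable_distr_eq)

lemma integrable_Y: "integrable M (Y i)"
proof -
  have "integrable (distr M borel (Y i)) (\<lambda>x. x)"
    using integrable_nu unfolding nu_def ident[of i] .
  then show ?thesis by (simp add: integrable_distr_eq)
qed

lemma integrable_S: "integrable M (S k)"
  unfolding S_def[abs_def] by (intro Bochner_Integration.integrable_sum integrable_Y)

lemma expectation_abs_S: "(\<integral>\<omega>. \<bar>S k \<omega>\<bar> \<partial>M) \<le> real k * (\<integral>x. \<bar>x\<bar> \<partial>nu)"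
proof -
  have Y: "(\<integral>\<omega>. \<bar>Y i \<omega>\<bar> \<partial>M) = (\<integral>x. \<bar>x\<bar> \<partial>nu)" for i
    unfolding nu_def ident[symmetric, of i] by (simp add: integral_distr)
  have "(\<integral>\<omega>. \<bar>S k \<omega>\<bar> \<partial>M) \<le> (\<integral>\<omega>. (\<Sum>i<k. \<bar>Y i \<omega>\<bar>) \<partial>M)"
    by (intro integral_mono integrable_abs integrable_S Bochner_Integration.integrable_sum integrable_Y)
      (auto simp: S_def)
  also have "\<dots> = real k * (\<integral>x. \<bar>x\<bar> \<partial>nu)"
    by (subst Bochner_Integration.integral_sum) (auto intro: integrable_Y simp: Y)
  finally show ?thesis .
qed

text \<open>\<open>S k\<close> involves only the indices below k, so \<open>Y k\<close> is a fresh
  summand. The available independence result yields the opposite order of the pair, hence the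
  swap.\<close>

lemma distr_S_Y: "mu k \<Otimes>\<^sub>M nu = distr M (borel \<Otimes>\<^sub>M borel) (\<lambda>\<omega>. (S k \<omega>, Y k \<omega>))"
proof -
  have "indep_var borel (Y k) borel (\<lambda>\<omega>. \<Sum>i\<in>{..<k}. Y i \<omega>)"
    by (rule indep_vars_sum) (auto intro: indep_vars_subset[OF indep])
  then have "indep_var borel (Y k) borel (S k)" by (simp add: S_def[abs_def])
  then have "distr M borel (Y k) \<Otimes>\<^sub>M distr M borel (S k) = distr M (borel \<Otimes>\<^sub>M borel) (\<lambda>\<omega>. (Y k \<omega>, S k \<omega>))"
    by (simp add: indep_var_distribution_eq)
  then have eq: "nu \<Otimes>\<^sub>M mu k = distr M (borel \<Otimes>\<^sub>M borel) (\<lambda>\<omega>. (Y k \<omega>, S k \<omega>))"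
    unfolding nu_def mu_def ident[of k] .
  interpret Q: pair_sigma_finite nu "mu k" ..
  have "mu k \<Otimes>\<^sub>M nu = distr (nu \<Otimes>\<^sub>M mu k) (mu k \<Otimes>\<^sub>M nu) (\<lambda>(x, y). (y, x))"
    by (rule MN.distr_pair_swap)
  also have "\<dots> = distr M (mu k \<Otimes>\<^sub>M nu) ((\<lambda>(x, y). (y, x)) \<circ> (\<lambda>\<omega>. (Y k \<omega>, S k \<omega>)))"
    unfolding eq by (subst distr_distr) auto
  also have "\<dots> = distr M (borel \<Otimes>\<^sub>M borel) (\<lambda>\<omega>. (S k \<omega>, Y k \<omega>))"
    by (intro distr_cong) (auto intro!: sets_pair_measure_cong)
  finally show ?thesis .
qed

lemma integrable_pair:
  fixes h :: "real \<times> real \<Rightarrow> real"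
  assumes [measurable]: "h \<in> borel_measurable (borel \<Otimes>\<^sub>M borel)"
    and i: "integrable M (\<lambda>\<omega>. h (S k \<omega>, Y k \<omega>))"
  shows "integrable (mu k \<Otimes>\<^sub>M nu) h"
proof -
  have "(\<lambda>\<omega>. (S k \<omega>, Y k \<omega>)) \<in> measurable M (borel \<Otimes>\<^sub>M borel)" by measurable
  from integrable_distr_eq[OF this assms(1)] i show ?thesis by (simp add: distr_S_Y)
qed

lemma integral_mu_Suc:
  fixes h :: "real \<Rightarrow> real"
  assumes [measurable]: "h \<in> borel_measurable borel" and i: "integrable (mu (Suc k)) h"
  shows "integrable (mu k \<Otimes>\<^sub>M nu) (\<lambda>(s, x). h (s + x))"
    "(\<integral>s. h s \<partial>mu (Suc k)) = (\<integral>s. (\<integral>x. h (s + x) \<partial>nu) \<partial>mu k)"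
proof -
  have S: "S (Suc k) \<omega> = S k \<omega> + Y k \<omega>" for \<omega> by (simp add: S_def)
  have "integrable M (\<lambda>\<omega>. h (S (Suc k) \<omega>))"
    using i unfolding mu_def by (subst (asm) integrable_distr_eq) auto
  then show *: "integrable (mu k \<Otimes>\<^sub>M nu) (\<lambda>(s, x). h (s + x))"
    by (intro integrable_pair) (auto simp: S)
  have "(\<integral>s. h s \<partial>mu (Suc k)) = (\<integral>\<omega>. h (S k \<omega> + Y k \<omega>) \<partial>M)"
    unfolding mu_def by (simp add: integral_distr S)
  also have "\<dots> = (\<integral>p. (\<lambda>(s, x). h (s + x)) p \<partial>(mu k \<Otimes>\<^sub>M nu))"
    unfolding distr_S_Y by (subst integral_distr) auto
  also have "\<dots> = (\<integral>s. (\<integral>x. h (s + x) \<partial>nu) \<partial>mu k)"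
    using MN.integral_fst'[OF *] by simp
  finally show "(\<integral>s. h s \<partial>mu (Suc k)) = (\<integral>s. (\<integral>x. h (s + x) \<partial>nu) \<partial>mu k)" .
qed

lemma integrable_times:
  fixes f :: "real \<Rightarrow> real"
  assumes [measurable]: "f \<in> borel_measurable borel" and b: "\<And>s. \<bar>f s\<bar> \<le> B"
    and i: "integrable N g" and [measurable]: "h \<in> borel_measurable N"
  shows "integrable N (\<lambda>s. (g s :: real) * f (h s))"
proof (rule Bochner_Integration.integrable_bound)
  show "integrable N (\<lambda>s. B * \<bar>g s\<bar>)" using i by simp
  have [measurable]: "g \<in> borel_measurable N" using i by auto
  show "(\<lambda>s. g s * f (h s)) \<in> borel_measurable N" by measurable
  have "norm (g s * f (h s)) \<le> norm (B * \<bar>g s\<bar>)" for s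
    using mult_left_mono[OF b[of "h s"], of "\<bar>g s\<bar>"] b[of "h s"]
    by (simp add: abs_mult mult.commute)
  then show "AE s in N. norm (g s * f (h s)) \<le> norm (B * \<bar>g s\<bar>)" by simp
qed

definition q :: "(real \<Rightarrow> real) \<Rightarrow> real \<Rightarrow> real" where
  "q f s = (\<integral>x. x * f (s + x) \<partial>nu)"

lemma q_measurable [measurable]:
  assumes [measurable]: "f \<in> borel_measurable borel" shows "q f \<in> borel_measurable borel"
  unfolding q_def[abs_def] by measurable

lemma q_bound:
  assumes f: "f \<in> borel_measurable borel" and b: "\<And>s. \<bar>f s\<bar> \<le> B"
  shows "\<bar>q f s\<bar> \<le> B * (\<integral>x. \<bar>x\<bar> \<partial>nu)"
proof -
  have "norm (q f s) \<le> (\<integral>x. B * \<bar>x\<bar> \<partial>nu)"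
    unfolding q_def
  proof (rule Bochner_Integration.integral_norm_bound_integral)
    show "integrable nu (\<lambda>x. x * f (s + x))"
      by (rule integrable_times[OF f b integrable_nu]) simp
    show "norm (x * f (s + x)) \<le> B * \<bar>x\<bar>" for x
      using mult_left_mono[OF b[of "s + x"], of "\<bar>x\<bar>"] by (simp add: abs_mult mult.commute)
  qed (simp add: integrable_nu)
  then show ?thesis by simp
qed

lemma integrable_mu: "integrable (mu k) (\<lambda>s. s)"
  unfolding mu_def using integrable_S by (simp add: integrable_distr_eq)

text \<open>By exchangeability each of the k + 1 summands contributes equally. Instead of permuting
  variables, the induction splits off the last summand x: its term gives one \<open>q f\<close>, and
  the rest s f(s + x) is the induction hypothesis for a translate of f, which is why f is
  generalised.\<close>

lemma moment_mu_Suc: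
  assumes f: "f \<in> borel_measurable borel" and b: "\<And>s. \<bar>f s\<bar> \<le> B"
  shows "(\<integral>s. s * f s \<partial>mu (Suc k)) = real (Suc k) * (\<integral>s. q f s \<partial>mu k)"
  using f b
proof (induction k arbitrary: f)
  case (0 f)
  note [measurable] = 0(1)
  have mu0: "(\<integral>s. g s \<partial>mu 0) = g 0" if [measurable]: "g \<in> borel_measurable borel" for g :: "real \<Rightarrow> real"
    unfolding mu_def by (subst integral_distr) (auto simp: S_def prob_space)
  have "(\<integral>s. s * f s \<partial>mu (Suc 0)) = (\<integral>s. (\<integral>x. (s + x) * f (s + x) \<partial>nu) \<partial>mu 0)"
    by (rule integral_mu_Suc(2)) (auto intro!: integrable_times[OF 0] integrable_mu)
  also have "\<dots> = (\<integral>s. q f s \<partial>mu 0)"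
    by (simp add: mu0 q_def)
  finally show ?case by simp
next
  case (Suc k f)
  note [measurable] = Suc.prems(1)
  let ?k = "Suc k"
  have i: "integrable (mu ?k \<Otimes>\<^sub>M nu) (\<lambda>(s, x). s * f (s + x))" (is "integrable _ ?h")
    by (rule integrable_pair) (auto intro!: integrable_times[OF Suc.prems integrable_S])
  have i': "integrable (mu ?k \<Otimes>\<^sub>M nu) (\<lambda>(s, x). x * f (s + x))" (is "integrable _ ?h'")
    by (rule integrable_pair) (auto intro!: integrable_times[OF Suc.prems integrable_Y])
  have "(\<integral>s. s * f s \<partial>mu (Suc ?k)) = (\<integral>s. (\<integral>x. (s + x) * f (s + x) \<partial>nu) \<partial>mu ?k)"
    by (rule integral_mu_Suc(2)) (auto intro!: integrable_times[OF Suc.prems] integrable_mu)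
  also have "\<dots> = (\<integral>s. (\<integral>x. s * f (s + x) \<partial>nu) + (\<integral>x. x * f (s + x) \<partial>nu) \<partial>mu ?k)"
  proof (rule Bochner_Integration.integral_cong[OF refl])
    fix s
    have "integrable nu (\<lambda>x. s * f (s + x))" "integrable nu (\<lambda>x. x * f (s + x))"
      by (rule integrable_times[OF Suc.prems]; simp add: integrable_nu)+
    then show "(\<integral>x. (s + x) * f (s + x) \<partial>nu) = (\<integral>x. s * f (s + x) \<partial>nu) + (\<integral>x. x * f (s + x) \<partial>nu)"
      by (simp add: distrib_right)
  qed
  also have "\<dots> = (\<integral>s. (\<integral>x. s * f (s + x) \<partial>nu) \<partial>mu ?k) + (\<integral>s. q f s \<partial>mu ?k)"
    using MN.integrable_fst'[OF i] MN.integrable_fst'[OF i'] unfolding q_def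
    by (subst Bochner_Integration.integral_add) auto
  also have "(\<integral>s. (\<integral>x. s * f (s + x) \<partial>nu) \<partial>mu ?k) = (\<integral>x. (\<integral>s. s * f (s + x) \<partial>mu ?k) \<partial>nu)"
    by (rule MN.Fubini_integral[OF i, symmetric])
  \<comment> \<open>The translate by x is applied at fixed x. Integrating x out afterwards restores
    the missing summand and leads from \<open>mu k\<close> back to
    \<open>mu (Suc k)\<close>.\<close>
  also have "\<dots> = (\<integral>x. real ?k * (\<integral>s. q (\<lambda>s. f (s + x)) s \<partial>mu k) \<partial>nu)"
    by (intro Bochner_Integration.integral_cong[OF refl] Suc.IH) (auto intro: Suc.prems)
  also have "\<dots> = real ?k * (\<integral>x. (\<integral>s. q f (s + x) \<partial>mu k) \<partial>nu)"
    by (simp add: q_def add_ac)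
  also have "(\<integral>x. (\<integral>s. q f (s + x) \<partial>mu k) \<partial>nu) = (\<integral>s. (\<integral>x. q f (s + x) \<partial>nu) \<partial>mu k)"
    by (rule MN.Fubini_integral)
      (auto intro!: MN.P.integrable_const_bound[where B="B * (\<integral>x. \<bar>x\<bar> \<partial>nu)"] simp: q_bound[OF Suc.prems])
  also have "\<dots> = (\<integral>s. q f s \<partial>mu ?k)"
    by (rule integral_mu_Suc(2)[symmetric])
      (auto intro!: mu.integrable_bounded[where B="B * (\<integral>x. \<bar>x\<bar> \<partial>nu)"] simp: q_bound[OF Suc.prems])
  finally show ?case by (simp add: algebra_simps)
qed

section \<open>Sums with a Poisson number of terms\<close>

context
  fixes r :: real assumes r: "r > 0"
begin

text \<open>The Poisson index lives on its own factor of a product space, so it is independent of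
  the summands by construction.\<close>

definition compound :: "real measure" where
  "compound = distr (measure_pmf (poisson_pmf r) \<Otimes>\<^sub>M M) borel (\<lambda>(k, \<omega>). S k \<omega>)"

lemma S_measurable_pair [measurable]:
  "(\<lambda>(k, \<omega>). S k \<omega>) \<in> borel_measurable (measure_pmf (poisson_pmf r) \<Otimes>\<^sub>M M)"
proof -
  have "(\<lambda>(k, \<omega>). S k \<omega>) \<in> borel_measurable (count_space UNIV \<Otimes>\<^sub>M M)"
    by (rule measurable_pair_measure_countable1) auto
  then show ?thesis by (simp cong: measurable_cong_sets sets_pair_measure_cong)
qed

interpretation C: pair_prob_space "measure_pmf (poisson_pmf r)" M ..

lemma real_distribution_compound: "real_distribution compound"
proof -
  have "prob_space compound" unfolding compound_def by (rule C.P.prob_space_distr) measurable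
  then show ?thesis
    by (simp add: real_distribution_def real_distribution_axioms_def compound_def)
qed

lemma integral_compound:
  fixes h :: "real \<Rightarrow> real"
  assumes [measurable]: "h \<in> borel_measurable borel" and i: "integrable compound h"
  shows "(\<integral>s. h s \<partial>compound) = (\<integral>k. (\<integral>s. h s \<partial>mu k) \<partial>measure_pmf (poisson_pmf r))"
proof -
  have *: "integrable (measure_pmf (poisson_pmf r) \<Otimes>\<^sub>M M) (\<lambda>(k, \<omega>). h (S k \<omega>))"
    using i unfolding compound_def by (subst (asm) integrable_distr_eq) (auto simp: case_prod_beta')
  have "(\<integral>s. h s \<partial>compound) = (\<integral>p. (\<lambda>(k, \<omega>). h (S k \<omega>)) p \<partial>(measure_pmf (poisson_pmf r) \<Otimes>\<^sub>M M))"
    unfolding compound_def by (subst integral_distr) (auto simp: case_prod_beta')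
  also have "\<dots> = (\<integral>k. (\<integral>\<omega>. h (S k \<omega>) \<partial>M) \<partial>measure_pmf (poisson_pmf r))"
    using C.integral_fst'[OF *] by simp
  also have "\<dots> = (\<integral>k. (\<integral>s. h s \<partial>mu k) \<partial>measure_pmf (poisson_pmf r))"
    unfolding mu_def by (simp add: integral_distr)
  finally show ?thesis .
qed

lemma integrable_compound: "integrable compound (\<lambda>s. s)"
proof -
  have "integrable (measure_pmf (poisson_pmf r) \<Otimes>\<^sub>M M) (\<lambda>(k, \<omega>). S k \<omega>)"
  proof (rule C.Fubini_integrable)
    show "integrable (measure_pmf (poisson_pmf r)) (\<lambda>k. \<integral>\<omega>. norm ((\<lambda>(k, \<omega>). S k \<omega>) (k, \<omega>)) \<partial>M)"
    proof (rule Bochner_Integration.integrable_bound)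
      \<comment> \<open>Integrability of the index itself is the shift lemma for a constant
        function.\<close>
      show "integrable (measure_pmf (poisson_pmf r)) (\<lambda>k. real k * (\<integral>x. \<bar>x\<bar> \<partial>nu))"
        by (rule poisson_shift(1)[OF r]) (rule order_refl)
      show "AE k in measure_pmf (poisson_pmf r).
        norm (\<integral>\<omega>. norm ((\<lambda>(k, \<omega>). S k \<omega>) (k, \<omega>)) \<partial>M) \<le> norm (real k * (\<integral>x. \<bar>x\<bar> \<partial>nu))"
        using expectation_abs_S by (simp add: abs_mult)
    qed simp
  qed (auto simp: integrable_S S_measurable_pair)
  then show ?thesis
    unfolding compound_def by (subst integrable_distr_eq) (auto simp: case_prod_beta')
qed

text \<open>Given k summands the left side is k times a mean over k - 1 of them; the Poisson
  recursion converts the factor k into r and restores the index.\<close>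

lemma mecke_compound:
  assumes f: "f \<in> borel_measurable borel" and b: "\<And>s. \<bar>f s\<bar> \<le> B"
  shows "(\<integral>s. s * f s \<partial>compound) = r * (\<integral>s. q f s \<partial>compound)"
proof -
  interpret c: real_distribution compound by (rule real_distribution_compound)
  note [measurable] = f
  let ?B = "B * (\<integral>x. \<bar>x\<bar> \<partial>nu)"
  have bq: "\<bar>\<integral>s. q f s \<partial>mu k\<bar> \<le> ?B" for k
  proof -
    have "norm (\<integral>s. q f s \<partial>mu k) \<le> (\<integral>s. ?B \<partial>mu k)"
      by (intro Bochner_Integration.integral_norm_bound_integral mu.integrable_bounded[where B="?B"])
        (use q_bound[OF f b] order_trans[OF abs_ge_zero q_bound[OF f b]] in auto)
    then show ?thesis using mu.prob_space[of k] by simp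
  qed
  have "(\<integral>s. s * f s \<partial>compound) = (\<integral>k. (\<integral>s. s * f s \<partial>mu k) \<partial>measure_pmf (poisson_pmf r))"
    by (rule integral_compound) (auto intro!: integrable_times[OF f b] integrable_compound)
  also have "\<dots> = (\<integral>k. real k * (\<integral>s. q f s \<partial>mu (k - 1)) \<partial>measure_pmf (poisson_pmf r))"
  proof (rule Bochner_Integration.integral_cong[OF refl])
    fix k
    show "(\<integral>s. s * f s \<partial>mu k) = real k * (\<integral>s. q f s \<partial>mu (k - 1))"
    proof (cases k)
      case 0
      then show ?thesis unfolding mu_def by (simp add: integral_distr S_def)
    next
      case (Suc j)
      then show ?thesis using moment_mu_Suc[OF f b] by simp
    qed
  qed
  also have "\<dots> = r * (\<integral>k. (\<integral>s. q f s \<partial>mu k) \<partial>measure_pmf (poisson_pmf r))"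
    by (rule poisson_shift(2)[OF r bq])
  also have "(\<integral>k. (\<integral>s. q f s \<partial>mu k) \<partial>measure_pmf (poisson_pmf r)) = (\<integral>s. q f s \<partial>compound)"
    by (rule integral_compound[symmetric])
      (auto intro!: c.integrable_bounded[where B="?B"] simp: q_bound[OF f b])
  finally show ?thesis .
qed

lemma measure_compound:
  "measure compound {..<x} = (\<integral>k. measure M {\<omega> \<in> space M. S k \<omega> < x} \<partial>measure_pmf (poisson_pmf r))"
proof -
  interpret c: real_distribution compound by (rule real_distribution_compound)
  have "measure compound {..<x} = (\<integral>s. indicator {..<x} s \<partial>compound)" by simp
  also have "\<dots> = (\<integral>k. (\<integral>s. indicator {..<x} s \<partial>mu k) \<partial>measure_pmf (poisson_pmf r))"
    by (rule integral_compound) (auto intro!: c.integrable_bounded[where B=1] simp: indicator_def)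
  also have "\<dots> = (\<integral>k. measure M {\<omega> \<in> space M. S k \<omega> < x} \<partial>measure_pmf (poisson_pmf r))"
  proof (rule Bochner_Integration.integral_cong[OF refl])
    fix k
    have "(\<integral>s. indicator {..<x} s \<partial>mu k) = measure (mu k) {..<x}" by simp
    also have "\<dots> = measure M (S k -` {..<x} \<inter> space M)"
      unfolding mu_def by (rule measure_distr) auto
    also have "S k -` {..<x} \<inter> space M = {\<omega> \<in> space M. S k \<omega> < x}" by auto
    finally show "(\<integral>s. indicator {..<x} s \<partial>mu k) = measure M {\<omega> \<in> space M. S k \<omega> < x}" .
  qed
  finally show ?thesis .
qed

lemma compound_poisson_clt:
  assumes mean: "expectation (Y 0) = 0" and sq: "integrable M (\<lambda>\<omega>. (Y 0 \<omega>)\<^sup>2)"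
    and var: "r * expectation (\<lambda>\<omega>. (Y 0 \<omega>)\<^sup>2) = 1"
  shows "\<bar>(\<integral>k. measure M {\<omega> \<in> space M. S k \<omega> < x} \<partial>measure_pmf (poisson_pmf r)) - Phi x\<bar>
    \<le> 1.8546 * (r * (\<integral>y. y\<^sup>2 * min 1 \<bar>y\<bar> \<partial>nu))"
proof -
  interpret c: real_distribution compound by (rule real_distribution_compound)
  interpret poisson_stein compound nu r
  proof
    show "(\<integral>x. x \<partial>nu) = 0" "integrable nu (\<lambda>x. x\<^sup>2)" "r * (\<integral>x. x\<^sup>2 \<partial>nu) = 1"
      using mean sq var unfolding nu_def by (simp_all add: integral_distr integrable_distr_eq)
    show "(\<integral>s. s * f s \<partial>compound) = r * (\<integral>s. (\<integral>x. x * f (s + x) \<partial>nu) \<partial>compound)"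
      if "f \<in> borel_measurable borel" "\<And>s. \<bar>f s\<bar> \<le> B" for f B
      using mecke_compound[OF that] by (simp only: q_def)
  qed (rule r integrable_compound)+
  show ?thesis using normal_approximation by (simp add: measure_compound)
qed

end

end

subsection \<open>Mixing over the Poisson parameter\<close>

lemma poisson_expectation:
  fixes h :: "nat \<Rightarrow> real"
  assumes r: "r > 0" and h: "\<And>k. \<bar>h k\<bar> \<le> B"
  shows "summable (\<lambda>k. norm (exp (- r) * r ^ k / fact k * h k))"
    "(\<integral>k. h k \<partial>measure_pmf (poisson_pmf r)) = (\<Sum>k. exp (- r) * r ^ k / fact k * h k)"
proof -
  have eq: "pmf (poisson_pmf r) k * h k = exp (- r) * r ^ k / fact k * h k" for k
    using r by simp
  have "integrable (measure_pmf (poisson_pmf r)) h"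
    by (rule measure_pmf.integrable_const_bound[where B=B]) (use h in auto)
  then have ih: "integrable (count_space UNIV) (\<lambda>k. pmf (poisson_pmf r) k * h k)"
    by (simp add: measure_pmf_eq_density integrable_density)
  then show "summable (\<lambda>k. norm (exp (- r) * r ^ k / fact k * h k))"
    by (simp only: integrable_count_space_nat_iff eq)
  have "(\<integral>k. h k \<partial>measure_pmf (poisson_pmf r)) = (\<integral>k. pmf (poisson_pmf r) k * h k \<partial>count_space UNIV)"
    by (simp add: measure_pmf_eq_density integral_density)
  also have "\<dots> = (\<Sum>k. pmf (poisson_pmf r) k * h k)" by (rule integral_count_space_nat[OF ih])
  finally show "(\<integral>k. h k \<partial>measure_pmf (poisson_pmf r)) = (\<Sum>k. exp (- r) * r ^ k / fact k * h k)"
    by (simp only: eq)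
qed

text \<open>The event is split along the values of \<open>N\<close>, each piece factorises by
  independence, and the mixed law turns the weights into integrals over \<Lambda>. Exchanging series
  and integral then leaves, at each l, a Poisson mean.\<close>

lemma mixed_poisson_sum:
  fixes X :: "nat \<Rightarrow> 'a \<Rightarrow> real" and \<Lambda> :: "'a \<Rightarrow> real" and N :: "'a \<Rightarrow> nat"
  assumes M: "prob_space M"
    and X: "\<And>i. X i \<in> borel_measurable M"
    and \<Lambda>: "\<Lambda> \<in> borel_measurable M" "AE \<omega> in M. \<Lambda> \<omega> > 0"
    and N: "N \<in> measurable M (count_space UNIV)"
    and indep: "prob_space.indep_set M
          (sets (vimage_algebra (space M) N (count_space UNIV)))
          (sets (vimage_algebra (space M) (\<lambda>\<omega> i. X i \<omega>) (Pi\<^sub>M UNIV (\<lambda>_. borel))))"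
    and law: "\<And>k. measure M {\<omega> \<in> space M. N \<omega> = k} =
          (\<integral>l. exp (- l) * l ^ k / fact k \<partial>(distr M borel \<Lambda>))"
  shows "integrable (distr M borel \<Lambda>)
      (\<lambda>l. \<Sum>k. exp (- l) * l ^ k / fact k * measure M {\<omega> \<in> space M. (\<Sum>i<k. X i \<omega>) < z})"
    "measure M {\<omega> \<in> space M. (\<Sum>i<N \<omega>. X i \<omega>) < z} = (\<integral>l. (\<Sum>k. exp (- l) * l ^ k / fact k *
        measure M {\<omega> \<in> space M. (\<Sum>i<k. X i \<omega>) < z}) \<partial>(distr M borel \<Lambda>))"
proof -
  interpret prob_space M by fact
  note [measurable] = X \<Lambda>(1) N
  define L where "L = distr M borel \<Lambda>"
  interpret L: real_distribution L unfolding L_def by (rule real_distribution_distr) measurable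
  have L_pos: "AE l in L. l > 0"
    unfolding L_def using \<Lambda>(2) by (subst AE_distr_iff) auto
  define F where "F k = measure M {\<omega> \<in> space M. (\<Sum>i<k. X i \<omega>) < z}" for k
  have F: "\<bar>F k\<bar> \<le> 1" for k by (simp add: F_def)
  let ?w = "\<lambda>k l. exp (- l) * l ^ k / fact k * F k"
  define A where "A k = {\<omega> \<in> space M. N \<omega> = k} \<inter> {\<omega> \<in> space M. (\<Sum>i<k. X i \<omega>) < z}" for k
  have Aeq: "measure M (A k) = (\<integral>l. ?w k l \<partial>L)" for k
  proof -
    have "N -` {k} \<inter> space M \<in> sets (vimage_algebra (space M) N (count_space UNIV))"
      by (rule in_vimage_algebra) simp
    moreover have "{f \<in> space (Pi\<^sub>M UNIV (\<lambda>_. borel :: real measure)). (\<Sum>i<k. f i) < z} \<in> sets (Pi\<^sub>M UNIV (\<lambda>_. borel))"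
      by measurable
    then have "(\<lambda>\<omega> i. X i \<omega>) -` {f \<in> space (Pi\<^sub>M UNIV (\<lambda>_. borel :: real measure)). (\<Sum>i<k. f i) < z} \<inter> space M
      \<in> sets (vimage_algebra (space M) (\<lambda>\<omega> i. X i \<omega>) (Pi\<^sub>M UNIV (\<lambda>_. borel)))"
      by (rule in_vimage_algebra)
    ultimately have "measure M ((N -` {k} \<inter> space M) \<inter>
        ((\<lambda>\<omega> i. X i \<omega>) -` {f \<in> space (Pi\<^sub>M UNIV (\<lambda>_. borel :: real measure)). (\<Sum>i<k. f i) < z} \<inter> space M))
      = measure M (N -` {k} \<inter> space M) *
        measure M ((\<lambda>\<omega> i. X i \<omega>) -` {f \<in> space (Pi\<^sub>M UNIV (\<lambda>_. borel :: real measure)). (\<Sum>i<k. f i) < z} \<inter> space M)"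
      by (rule indep_setD[OF indep])
    moreover have "N -` {k} \<inter> space M = {\<omega> \<in> space M. N \<omega> = k}" by auto
    moreover have "(\<lambda>\<omega> i. X i \<omega>) -` {f \<in> space (Pi\<^sub>M UNIV (\<lambda>_. borel :: real measure)). (\<Sum>i<k. f i) < z} \<inter> space M
      = {\<omega> \<in> space M. (\<Sum>i<k. X i \<omega>) < z}" by (auto simp: space_PiM)
    ultimately have "measure M (A k) = measure M {\<omega> \<in> space M. N \<omega> = k} * F k"
      by (simp add: A_def F_def)
    then show ?thesis by (simp add: law L_def)
  qed
  have iw: "integrable L (?w k)" for k
  proof (rule Bochner_Integration.integrable_bound[OF L.integrable_const[of 1]])
    show "AE l in L. norm (?w k l) \<le> norm (1::real)"
      using L_pos
    proof eventually_elim
      case (elim l)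
      \<comment> \<open>For positive l the kernel is a Poisson weight and thus lies in
        [0, 1].\<close>
      have "exp (- l) * l ^ k / fact k = pmf (poisson_pmf l) k" using elim by simp
      then have "0 \<le> exp (- l) * l ^ k / fact k" "exp (- l) * l ^ k / fact k \<le> 1"
        by (simp_all only: pmf_le_1 pmf_nonneg)
      then show ?case
        using mult_mono[of "exp (- l) * l ^ k / fact k" 1 "\<bar>F k\<bar>" 1] F[of k] elim by (simp add: abs_mult)
    qed
  qed measurable
  have "(\<lambda>k. measure M (A k)) sums measure M (\<Union>k. A k)"
    by (rule finite_measure_UNION) (auto simp: A_def disjoint_family_on_def)
  moreover have "(\<Union>k. A k) = {\<omega> \<in> space M. (\<Sum>i<N \<omega>. X i \<omega>) < z}"
    by (auto simp: A_def)
  ultimately have sums: "(\<lambda>k. \<integral>l. ?w k l \<partial>L) sums measure M {\<omega> \<in> space M. (\<Sum>i<N \<omega>. X i \<omega>) < z}"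
    by (simp only: Aeq)
  have norms: "(\<integral>l. norm (?w k l) \<partial>L) = (\<integral>l. ?w k l \<partial>L)" for k
  proof (rule integral_cong_AE)
    show "AE l in L. norm (?w k l) = ?w k l"
      using L_pos by eventually_elim (simp add: F_def)
  qed (use iw in auto)
  have AEs: "AE l in L. summable (\<lambda>k. norm (?w k l))"
    using L_pos by eventually_elim (rule poisson_expectation(1)[OF _ F])
  \<comment> \<open>The terms are nonnegative almost everywhere, so this summability is countable
    additivity over the disjoint pieces.\<close>
  have sm: "summable (\<lambda>k. \<integral>l. norm (?w k l) \<partial>L)"
    unfolding norms using sums by (rule sums_summable)
  have "integrable L (\<lambda>l. \<Sum>k. ?w k l)"
    by (rule integrable_suminf[OF iw AEs sm])
  then show "integrable (distr M borel \<Lambda>)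
      (\<lambda>l. \<Sum>k. exp (- l) * l ^ k / fact k * measure M {\<omega> \<in> space M. (\<Sum>i<k. X i \<omega>) < z})"
    by (simp only: L_def F_def)
  have "(\<integral>l. (\<Sum>k. ?w k l) \<partial>L) = (\<Sum>k. \<integral>l. ?w k l \<partial>L)"
    by (rule integral_suminf[OF iw AEs sm])
  also have "\<dots> = measure M {\<omega> \<in> space M. (\<Sum>i<N \<omega>. X i \<omega>) < z}"
    using sums by (rule sums_unique[symmetric])
  finally show "measure M {\<omega> \<in> space M. (\<Sum>i<N \<omega>. X i \<omega>) < z} = (\<integral>l. (\<Sum>k. exp (- l) * l ^ k / fact k *
        measure M {\<omega> \<in> space M. (\<Sum>i<k. X i \<omega>) < z}) \<partial>(distr M borel \<Lambda>))"
    by (simp only: L_def F_def)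
qed

theorem theorem9:
  fixes M :: "'a measure"
    and X :: "nat \<Rightarrow> 'a \<Rightarrow> real"
    and \<Lambda> :: "'a \<Rightarrow> real"
    and N :: "'a \<Rightarrow> nat"
    and \<sigma> :: real
  assumes "prob_space M"
    and X_meas: "\<And>i. X i \<in> borel_measurable M"
    and X_indep: "prob_space.indep_vars M (\<lambda>_. borel) X UNIV"
    and X_ident: "\<And>i. distr M borel (X i) = distr M borel (X 0)"
    and X_int: "integrable M (X 0)"
    and X_mean: "integral\<^sup>L M (X 0) = 0"
    and X_sq_int: "integrable M (\<lambda>\<omega>. (X 0 \<omega>)\<^sup>2)"
    and sigma_pos: "\<sigma> > 0"
    and sigma_sq: "integral\<^sup>L M (\<lambda>\<omega>. (X 0 \<omega>)\<^sup>2) = \<sigma>\<^sup>2"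
    and Lam_meas: "\<Lambda> \<in> borel_measurable M"
    and Lam_pos: "AE \<omega> in M. \<Lambda> \<omega> > 0"
    and Lam_int: "integrable M \<Lambda>"
    and N_meas: "N \<in> measurable M (count_space UNIV)"
    and N_indep: "prob_space.indep_set M
          (sets (vimage_algebra (space M) N (count_space UNIV)))
          (sets (vimage_algebra (space M) (\<lambda>\<omega> i. X i \<omega>) (Pi\<^sub>M UNIV (\<lambda>_. borel))))"
    and N_mixed_poisson: "\<And>k. measure M {\<omega> \<in> space M. N \<omega> = k} =
          (\<integral>l. exp (- l) * l ^ k / fact k \<partial>(distr M borel \<Lambda>))"
  shows "(\<forall>x::real.
            \<bar>measure M {\<omega> \<in> space M.
                 (\<Sum>i<N \<omega>. X i \<omega>) < x * \<sigma> * sqrt (integral\<^sup>L M \<Lambda>)}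
             - (\<integral>l. Phi (x / sqrt l) \<partial>(distr M borel (\<lambda>\<omega>. \<Lambda> \<omega> / integral\<^sup>L M \<Lambda>)))\<bar>
            \<le> 1.8546 / \<sigma>\<^sup>2 *
               (\<integral>(u, l). u\<^sup>2 * min 1 (\<bar>u\<bar> / (\<sigma> * sqrt l))
                  \<partial>(distr M borel (X 0) \<Otimes>\<^sub>M distr M borel \<Lambda>)))
         \<and> 1.8546 / \<sigma>\<^sup>2 *
               (\<integral>(u, l). u\<^sup>2 * min 1 (\<bar>u\<bar> / (\<sigma> * sqrt l))
                  \<partial>(distr M borel (X 0) \<Otimes>\<^sub>M distr M borel \<Lambda>))
           = 1.8546 / \<sigma>\<^sup>2 *
               ((\<integral>(u, l). (if \<sigma> * sqrt l \<le> \<bar>u\<bar> then u\<^sup>2 else 0)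
                  \<partial>(distr M borel (X 0) \<Otimes>\<^sub>M distr M borel \<Lambda>))
              + (\<integral>(u, l). (if \<bar>u\<bar> < \<sigma> * sqrt l then \<bar>u\<bar> ^ 3 / (\<sigma> * sqrt l) else 0)
                  \<partial>(distr M borel (X 0) \<Otimes>\<^sub>M distr M borel \<Lambda>)))"
proof -
  interpret prob_space M by fact
  note [measurable] = X_meas Lam_meas N_meas
  define L where "L = distr M borel \<Lambda>"
  define nu where "nu = distr M borel (X 0)"
  interpret nu: real_distribution nu unfolding nu_def by (rule real_distribution_distr) measurable
  interpret L: real_distribution L unfolding L_def by (rule real_distribution_distr) measurable
  interpret P: pair_prob_space nu L ..
  \<comment> \<open>For l <= 0 the kernel and the quotients by square roots have no probabilistic
    meaning, so every estimate in l is made almost everywhere.\<close>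
  have L_pos: "AE l in L. l > 0"
    unfolding L_def using Lam_pos by (subst AE_distr_iff) auto
  have P_pos: "AE p in nu \<Otimes>\<^sub>M L. snd p > 0"
  proof (rule P.AE_pair_measure)
    show "{p \<in> space (nu \<Otimes>\<^sub>M L). snd p > 0} \<in> sets (nu \<Otimes>\<^sub>M L)" by measurable
  qed (use L_pos in simp)
  have nu_sq: "integrable nu (\<lambda>u. u\<^sup>2)"
    unfolding nu_def using X_sq_int by (simp add: integrable_distr_eq)
  have P_sq: "integrable (nu \<Otimes>\<^sub>M L) (\<lambda>p. (fst p)\<^sup>2)"
    by (rule P.Fubini_integrable) (auto simp: nu_sq L.prob_space[simplified])
  have P_int: "integrable (nu \<Otimes>\<^sub>M L) h"
    if "h \<in> borel_measurable (borel \<Otimes>\<^sub>M borel)" and le: "\<And>u l. l > 0 \<Longrightarrow> \<bar>h (u, l)\<bar> \<le> u\<^sup>2"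
    for h :: "real \<times> real \<Rightarrow> real"
  proof (rule Bochner_Integration.integrable_bound[OF P_sq])
    show "h \<in> borel_measurable (nu \<Otimes>\<^sub>M L)" using that(1) by measurable
    show "AE p in nu \<Otimes>\<^sub>M L. norm (h p) \<le> norm ((fst p)\<^sup>2)"
      using P_pos by eventually_elim (use le in \<open>auto simp: prod_eq_iff\<close>)
  qed
  let ?h = "\<lambda>(u, l). u\<^sup>2 * min 1 (\<bar>u\<bar> / (\<sigma> * sqrt l))"
  let ?h1 = "\<lambda>(u, l). (if \<sigma> * sqrt l \<le> \<bar>u\<bar> then u\<^sup>2 else 0)"
  let ?h2 = "\<lambda>(u, l). (if \<bar>u\<bar> < \<sigma> * sqrt l then \<bar>u\<bar> ^ 3 / (\<sigma> * sqrt l) else 0)"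
  have split: "?h (u, l) = ?h1 (u, l) + ?h2 (u, l)" if "l > 0" for u l
  proof -
    have pos: "\<sigma> * sqrt l > 0" using that sigma_pos by simp
    show ?thesis
    proof (cases "\<sigma> * sqrt l \<le> \<bar>u\<bar>")
      case True
      then have "min 1 (\<bar>u\<bar> / (\<sigma> * sqrt l)) = 1" using pos by (simp add: min_absorb1)
      with True show ?thesis by simp
    next
      case False
      then have "min 1 (\<bar>u\<bar> / (\<sigma> * sqrt l)) = \<bar>u\<bar> / (\<sigma> * sqrt l)"
        using pos by (intro min_absorb2) simp
      moreover have "\<bar>u\<bar> ^ 3 = u\<^sup>2 * \<bar>u\<bar>" by (simp add: power3_eq_cube power2_eq_square abs_mult_self_eq)
      ultimately show ?thesis using False by simp
    qed
  qed
  have h_bound: "0 \<le> ?h (u, l)" "?h (u, l) \<le> u\<^sup>2" if "l > 0" for u l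
    using that sigma_pos by (auto intro!: mult_nonneg_nonneg mult_left_le)
  have nn: "0 \<le> ?h1 (u, l)" "0 \<le> ?h2 (u, l)" if "l > 0" for u l
    using that sigma_pos by auto
  have i: "integrable (nu \<Otimes>\<^sub>M L) ?h" "integrable (nu \<Otimes>\<^sub>M L) ?h1" "integrable (nu \<Otimes>\<^sub>M L) ?h2"
  proof -
    have "\<bar>?h (u, l)\<bar> \<le> u\<^sup>2" "\<bar>?h1 (u, l)\<bar> \<le> u\<^sup>2" "\<bar>?h2 (u, l)\<bar> \<le> u\<^sup>2" if "l > 0" for u l
      using h_bound[OF that, of u] split[OF that, of u] nn[OF that, of u] by linarith+
    then show "integrable (nu \<Otimes>\<^sub>M L) ?h" "integrable (nu \<Otimes>\<^sub>M L) ?h1" "integrable (nu \<Otimes>\<^sub>M L) ?h2"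
      by (intro P_int; measurable)+
  qed
  have eq: "(\<integral>p. ?h p \<partial>(nu \<Otimes>\<^sub>M L)) = (\<integral>p. ?h1 p \<partial>(nu \<Otimes>\<^sub>M L)) + (\<integral>p. ?h2 p \<partial>(nu \<Otimes>\<^sub>M L))"
  proof -
    have "(\<integral>p. ?h p \<partial>(nu \<Otimes>\<^sub>M L)) = (\<integral>p. ?h1 p + ?h2 p \<partial>(nu \<Otimes>\<^sub>M L))"
    proof (rule integral_cong_AE)
      show "AE p in nu \<Otimes>\<^sub>M L. ?h p = ?h1 p + ?h2 p"
        using P_pos by eventually_elim (use split in \<open>auto simp: case_prod_beta\<close>)
    qed (use i in auto)
    then show ?thesis using i by simp
  qed
  have bound: "\<bar>measure M {\<omega> \<in> space M. (\<Sum>i<N \<omega>. X i \<omega>) < x * \<sigma> * sqrt (integral\<^sup>L M \<Lambda>)}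
      - (\<integral>l. Phi (x / sqrt l) \<partial>(distr M borel (\<lambda>\<omega>. \<Lambda> \<omega> / integral\<^sup>L M \<Lambda>)))\<bar>
    \<le> 1.8546 / \<sigma>\<^sup>2 * (\<integral>p. ?h p \<partial>(nu \<Otimes>\<^sub>M L))" for x
  proof -
    define z where "z = x * \<sigma> * sqrt (integral\<^sup>L M \<Lambda>)"
    define F where "F k = measure M {\<omega> \<in> space M. (\<Sum>i<k. X i \<omega>) < z}" for k
    define G where "G l = (\<Sum>k. exp (- l) * l ^ k / fact k * F k)" for l
    have F: "\<bar>F k\<bar> \<le> 1" for k by (simp add: F_def)
    note mixture = mixed_poisson_sum[OF \<open>prob_space M\<close> X_meas Lam_meas Lam_pos N_meas N_indep N_mixed_poisson, of z,
        folded L_def F_def, folded G_def]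
    have clt: "\<bar>G l - Phi (z / (\<sigma> * sqrt l))\<bar> \<le> 1.8546 / \<sigma>\<^sup>2 * (\<integral>u. ?h (u, l) \<partial>nu)" if l: "l > 0" for l
    proof -
      let ?b = "\<sigma> * sqrt l"
      have b: "?b > 0" using sigma_pos l by simp
      \<comment> \<open>This scaling makes l E Y^2 = 1. Undoing it, the factor l cancels and the
        error quantity becomes the integral of \<open>?h\<close> at l divided by \<sigma>
        squared.\<close>
      define Y where "Y i \<omega> = X i \<omega> / ?b" for i \<omega>
      interpret Y: iid_seq M Y
      proof
        show "Y i \<in> borel_measurable M" for i unfolding Y_def by measurable
        show "indep_vars (\<lambda>_. borel) Y UNIV"
          unfolding Y_def by (rule indep_vars_compose2[OF X_indep]) measurable
        have *: "distr M borel (Y i) = distr (distr M borel (X i)) borel (\<lambda>u. u / ?b)" for i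
          by (subst distr_distr) (auto simp: Y_def[abs_def] comp_def)
        show "distr M borel (Y i) = distr M borel (Y 0)" for i
          unfolding * X_ident[of i] ..
        show "integrable M (Y 0)" unfolding Y_def using X_int by simp
      qed
      have "(\<integral>k. measure M {\<omega> \<in> space M. Y.S k \<omega> < z / ?b} \<partial>measure_pmf (poisson_pmf l)) = G l"
      proof -
        have "u / ?b < v / ?b \<longleftrightarrow> u < v" for u v
          using divide_strict_right_mono[OF _ b] by (metis linorder_not_less order_le_less)
        then have S: "Y.S k \<omega> < z / ?b \<longleftrightarrow> (\<Sum>i<k. X i \<omega>) < z" for k \<omega>
          by (simp only: Y.S_def Y_def sum_divide_distrib[symmetric])
        show ?thesis
          unfolding S G_def F_def[symmetric]
          by (subst poisson_expectation[OF l F]) (simp add: mult_ac)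
      qed
      moreover have "l * (\<integral>y. y\<^sup>2 * min 1 \<bar>y\<bar> \<partial>Y.nu) = (\<integral>u. ?h (u, l) \<partial>nu) / \<sigma>\<^sup>2"
      proof -
        have "(\<integral>y. y\<^sup>2 * min 1 \<bar>y\<bar> \<partial>Y.nu) = (\<integral>\<omega>. (Y 0 \<omega>)\<^sup>2 * min 1 \<bar>Y 0 \<omega>\<bar> \<partial>M)"
          unfolding Y.nu_def by (rule integral_distr) auto
        also have "\<dots> = (\<integral>u. (u / ?b)\<^sup>2 * min 1 \<bar>u / ?b\<bar> \<partial>nu)"
          unfolding nu_def Y_def by (rule integral_distr[symmetric]) auto
        also have "\<dots> = (\<integral>u. ?h (u, l) / (\<sigma>\<^sup>2 * l) \<partial>nu)"
          using b l sigma_pos by (simp add: power_divide power_mult_distrib abs_mult)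
        also have "\<dots> = (\<integral>u. ?h (u, l) \<partial>nu) / (\<sigma>\<^sup>2 * l)" by simp
        finally show ?thesis using l by simp
      qed
      moreover have "expectation (Y 0) = 0" "integrable M (\<lambda>\<omega>. (Y 0 \<omega>)\<^sup>2)"
        "l * expectation (\<lambda>\<omega>. (Y 0 \<omega>)\<^sup>2) = 1"
        unfolding Y_def power_divide using X_mean X_sq_int sigma_sq b l sigma_pos
        by (simp_all add: power_mult_distrib)
      ultimately show ?thesis
        using Y.compound_poisson_clt[OF l, of "z / ?b"] by simp
    qed
    \<comment> \<open>Normalising \<Lambda> by its mean puts the same factor sqrt(E \<Lambda>) into
      the argument of \<open>Phi\<close> that z carries, so both mixtures run over the law
      \<open>L\<close>.\<close>
    have "(\<integral>l. Phi (x / sqrt l) \<partial>(distr M borel (\<lambda>\<omega>. \<Lambda> \<omega> / integral\<^sup>L M \<Lambda>)))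
        = (\<integral>\<omega>. Phi (x / sqrt (\<Lambda> \<omega> / integral\<^sup>L M \<Lambda>)) \<partial>M)"
      by (rule integral_distr) measurable
    also have "\<dots> = (\<integral>\<omega>. Phi (z / (\<sigma> * sqrt (\<Lambda> \<omega>))) \<partial>M)"
      using sigma_pos by (simp add: z_def real_sqrt_divide)
    also have "\<dots> = (\<integral>l. Phi (z / (\<sigma> * sqrt l)) \<partial>L)"
      unfolding L_def by (rule integral_distr[symmetric]) measurable
    finally have Phi_int: "(\<integral>l. Phi (x / sqrt l) \<partial>(distr M borel (\<lambda>\<omega>. \<Lambda> \<omega> / integral\<^sup>L M \<Lambda>)))
        = (\<integral>l. Phi (z / (\<sigma> * sqrt l)) \<partial>L)" .
    have iPhi: "integrable L (\<lambda>l. Phi (z / (\<sigma> * sqrt l)))"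
      by (rule L.integrable_bounded[where B=1]) (auto simp: Phi_nonneg Phi_le_1)
    have "norm ((\<integral>l. G l \<partial>L) - (\<integral>l. Phi (z / (\<sigma> * sqrt l)) \<partial>L)) 
        = norm (\<integral>l. G l - Phi (z / (\<sigma> * sqrt l)) \<partial>L)"
      using mixture(1) iPhi by simp
    also have "\<dots> \<le> (\<integral>l. norm (G l - Phi (z / (\<sigma> * sqrt l))) \<partial>L)"
      by (rule integral_norm_bound)
    also have "\<dots> \<le> (\<integral>l. 1.8546 / \<sigma>\<^sup>2 * (\<integral>u. ?h (u, l) \<partial>nu) \<partial>L)"
    proof (rule integral_mono_AE)
      show "integrable L (\<lambda>l. norm (G l - Phi (z / (\<sigma> * sqrt l))))"
        using mixture(1) iPhi by simp
      show "integrable L (\<lambda>l. 1.8546 / \<sigma>\<^sup>2 * (\<integral>u. ?h (u, l) \<partial>nu))"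
        using P.integrable_snd[of "\<lambda>u l. ?h (u, l)"] i(1) by (intro integrable_mult_right) simp
      show "AE l in L. norm (G l - Phi (z / (\<sigma> * sqrt l))) \<le> 1.8546 / \<sigma>\<^sup>2 * (\<integral>u. ?h (u, l) \<partial>nu)"
        using L_pos by eventually_elim (use clt in simp)
    qed
    also have "\<dots> = 1.8546 / \<sigma>\<^sup>2 * (\<integral>l. (\<integral>u. ?h (u, l) \<partial>nu) \<partial>L)"
      by (rule integral_mult_right_zero)
    also have "(\<integral>l. (\<integral>u. ?h (u, l) \<partial>nu) \<partial>L) = (\<integral>p. ?h p \<partial>(nu \<Otimes>\<^sub>M L))"
      using P.integral_snd[of "\<lambda>u l. ?h (u, l)"] i(1) by simp
    finally show ?thesis
      unfolding Phi_int z_def[symmetric] mixture(2) by simp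
  qed
  show ?thesis
    using bound eq unfolding nu_def L_def by simp
qed

end
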